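(* Let $d\ge1$. There is a constant $C=C(d)>0$ such that the following holds. Let $W$ be a $d\times d$ matrix weight on $J=[0,1]$ that is invertible almost everywhere and such that $W^{-1}$ has integrable entries on $J$. Given $f\in L^2_{\mathbb{C}^d}(W)$, there exists a sparse collection $\mathcal{S}\subset\mathcal{D}$ such that $$\|S_Wf\|_{L^2_{\mathbb{R}}}^2\le C\sum_{I\in\mathcal{S}}\big\langle\|\langle W\rangle_I^{1/2}f\|_{\mathbb{C}^d}\big\rangle_I^2\,|I| = C\,\Big\|\Big(\sum_{I\in\mathcal{S}}\big\langle\|\langle W\rangle_I^{1/2}f\|_{\mathbb{C}^d}\big\rangle_I^2\,\chi_I\Big)^{1/2}\Big\|_{L^2_{\mathbb{R}}}^2.$$
   Context: Let $J=[0,1]$ and let $\mathcal{D}$ be the collection of dyadic subintervals of $J$ (including $J$). For a (scalar-, vector- or matrix-valued) function $g$ and an interval $I$, $\langle g\rangle_I=\frac{1}{|I|}\int_I g(x)\,dx$; $\chi_I$ is the indicator function of $I$. Thus $\langle\|\langle W\rangle_I^{1/2}f\|_{\mathbb{C}^d}\rangle_I=\frac{1}{|I|}\int_I\|\langle W\rangle_I^{1/2}f(x)\|_{\mathbb{C}^d}\,dx$. The bracket with two arguments $\langle\cdot,\cdot\rangle_{\mathbb{C}^d}$ is the standard inner product of $\mathbb{C}^d$ and $\|\cdot\|_{\mathbb{C}^d}$ its norm. A collection of intervals $\mathcal{S}\subset\mathcal{D}$ is called sparse if there are pairwise disjoint (measurable) subsets $E(I)\subset I$, $I\in\mathcal{S}$,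 such that $|E(I)|\ge\frac12|I|$ for every $I\in\mathcal{S}$. A weight (matrix weight) is a $d\times d$ matrix-valued function $W$ on $J$ with integrable entries such that $W(x)$ is (Hermitian) positive semidefinite for almost every $x$. $L^2_{\mathbb{C}^d}(W)$ is the space of measurable $f:J\to\mathbb{C}^d$ with $\|f\|_{L^2_{\mathbb{C}^d}(W)}^2=\int_J\|W^{1/2}(x)f(x)\|_{\mathbb{C}^d}^2\,dx=\int_J\langle W(x)f(x),f(x)\rangle_{\mathbb{C}^d}\,dx<\infty$. $L^2_{\mathbb{R}}$ is the unweighted $L^2$ space of real-valued functions on $J$. Haar functions: $h_I=|I|^{-1/2}(\chi_{I_+}-\chi_{I_-})$, where $I_\pm$ are the two dyadic halves of $I$. For $f:J\to\mathbb{C}^d$ integrable, $(f,h_I)=\int_J f(x)h_I(x)\,dx\in\mathbb{C}^d$. For signs $\sigma=(\sigma_I)_{I\in\mathcal{D}}$, $\sigma_I=\pm1$, let $T_\sigma f(x)=\sum_{I\in\mathcal{D}}\sigma_I (f,h_I)h_I(x)$. Matrix-weighted square function: $S_Wf(x)\ge 0$ is defined by $S_Wf(x)^2=\mathbb{E}\big(\|W(x)^{1/2}T_\sigma f(x)\|_{\mathbb{C}^d}^2\big)$, where $\mathbb{E}$ is the expectation over independent uniformly distributed random signs $\sigma_I=\pm1$; equivalently, $S_Wf(x)^2=\sum_{I\in\mathcal{D}}\|W(x)^{1/2}(f,h_I)\|_{\mathbb{C}^d}^2\frac{\chi_I(x)}{|I|}$, so that $\|S_Wf\|_{L^2_{\mathbb{R}}}^2=\sum_{I\in\mathcal{D}}\big\langle\langle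 W\rangle_I(f,h_I),(f,h_I)\big\rangle_{\mathbb{C}^d}$. *)

theory Defs
  imports "HOL-Probability.Probability"
begin

abbreviation J :: "real set" where
  "J \<equiv> {0..1}"

abbreviation leb_J :: "real measure" where
  "leb_J \<equiv> lebesgue_on J"


section \<open>Dyadic intervals, averages and sparse collections\<close>

text \<open>Dyadic intervals are closed, since \<open>J = [0,1]\<close> is one of them. The halves of a dyadic
  interval are closed as well; all overlaps are finite sets, hence null.\<close>

definition dyadic_gen :: "nat \<Rightarrow> real set set" where
  "dyadic_gen n = {{real k / 2 ^ n .. (real k + 1) / 2 ^ n} | k. k < 2 ^ n}"

definition dyadic :: "real set set" where
  "dyadic = (\<Union>n. dyadic_gen n)"

definition left_half :: "real set \<Rightarrow> real set" where
  "left_half I = {Inf I .. (Inf I + Sup I) / 2}"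

definition right_half :: "real set \<Rightarrow> real set" where
  "right_half I = {(Inf I + Sup I) / 2 .. Sup I}"

definition len :: "real set \<Rightarrow> real" where
  "len I = measure lebesgue I"

definition average :: "(real \<Rightarrow> 'b :: {banach, second_countable_topology}) \<Rightarrow> real set \<Rightarrow> 'b" where
  "average g I = (1 / len I) *\<^sub>R (\<integral>x. g x \<partial>lebesgue_on I)"

definition sparse_collection :: "real set set \<Rightarrow> bool" where
  "sparse_collection S \<longleftrightarrow> S \<subseteq> dyadic \<and>
     (\<exists>E. (\<forall>I\<in>S. E I \<subseteq> I \<and> E I \<in> sets lebesgue \<and> measure lebesgue (E I) \<ge> 1 / 2 * len I) \<and>
          disjoint_family_on E S)"


section \<open>Positive semidefinite matrices and matrix weights\<close>

definition cdot :: "complex ^ 'd \<Rightarrow> complex ^ 'd \<Rightarrow> complex" where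
  "cdot v w = (\<Sum>i\<in>UNIV. v $ i * cnj (w $ i))"

definition hermitian :: "complex ^ 'd ^ 'd \<Rightarrow> bool" where
  "hermitian A \<longleftrightarrow> (\<forall>i j. A $ i $ j = cnj (A $ j $ i))"

text \<open>For Hermitian \<open>A\<close> the number \<open>cdot (A *v v) v\<close> is real.\<close>

definition psd :: "complex ^ 'd ^ 'd \<Rightarrow> bool" where
  "psd A \<longleftrightarrow> hermitian A \<and> (\<forall>v. 0 \<le> Re (cdot (A *v v) v))"

text \<open>The positive semidefinite square root; meaningful for positive semidefinite \<open>A\<close> only.\<close>

definition msqrt :: "complex ^ 'd ^ 'd \<Rightarrow> complex ^ 'd ^ 'd" where
  "msqrt A = (THE B. psd B \<and> B ** B = A)"

definition integrable_entries :: "(real \<Rightarrow> complex ^ 'd ^ 'd) \<Rightarrow> bool" where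
  "integrable_entries W \<longleftrightarrow> (\<forall>i j. integrable leb_J (\<lambda>x. W x $ i $ j))"

definition matrix_weight :: "(real \<Rightarrow> complex ^ 'd ^ 'd) \<Rightarrow> bool" where
  "matrix_weight W \<longleftrightarrow> integrable_entries W \<and> (AE x in leb_J. psd (W x))"

definition weighted_L2 :: "(real \<Rightarrow> complex ^ 'd ^ 'd) \<Rightarrow> (real \<Rightarrow> complex ^ 'd) set" where
  "weighted_L2 W = {f. f \<in> borel_measurable leb_J \<and>
     (\<integral>\<^sup>+x. ennreal ((norm (msqrt (W x) *v f x))\<^sup>2) \<partial>leb_J) < \<infinity>}"


section \<open>The scalar L2 norm\<close>

text \<open>Square functions and their norms may be infinite, so both take values in \<open>[0,\<infinity>]\<close>.\<close>

definition ennsqrt :: "ennreal \<Rightarrow> ennreal" where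
  "ennsqrt t = (if t = \<infinity> then \<infinity> else ennreal (sqrt (enn2real t)))"

lemma ennsqrt_power2: "(ennsqrt t)\<^sup>2 = t"
  by (cases t) (auto simp: ennsqrt_def ennreal_power ennreal_top_mult power2_eq_square
      simp flip: ennreal_mult)

definition L2_norm :: "(real \<Rightarrow> ennreal) \<Rightarrow> ennreal" where
  "L2_norm g = ennsqrt (\<integral>\<^sup>+x. (g x)\<^sup>2 \<partial>leb_J)"


section \<open>Haar multipliers and the matrix-weighted square function\<close>

definition haar :: "real set \<Rightarrow> real \<Rightarrow> real" where
  "haar I x = (indicator (right_half I) x - indicator (left_half I) x) / sqrt (len I)"

definition haar_coeff :: "(real \<Rightarrow> complex ^ 'd) \<Rightarrow> real set \<Rightarrow> complex ^ 'd" where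
  "haar_coeff f I = (\<integral>x. haar I x *\<^sub>R f x \<partial>leb_J)"

text \<open>The series over all dyadic intervals is summed generation by generation, each generation
  being finite. For integrable \<open>f\<close> and almost every \<open>x\<close> it converges for almost every choice of
  the signs, though in general not absolutely.\<close>

definition haar_multiplier ::
    "(real set \<Rightarrow> real) \<Rightarrow> (real \<Rightarrow> complex ^ 'd) \<Rightarrow> real \<Rightarrow> complex ^ 'd" where
  "haar_multiplier \<sigma> f x =
     (\<Sum>n. \<Sum>I\<in>dyadic_gen n. (\<sigma> I * haar I x) *\<^sub>R haar_coeff f I)"

definition random_signs :: "(real set \<Rightarrow> real) measure" where
  "random_signs = (\<Pi>\<^sub>M I\<in>dyadic. measure_pmf (pmf_of_set {-1, 1}))"

definition square_function ::
    "(real \<Rightarrow> complex ^ 'd ^ 'd) \<Rightarrow> (real \<Rightarrow> complex ^ 'd) \<Rightarrow> real \<Rightarrow> ennreal" where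
  "square_function W f x =
     ennsqrt (\<integral>\<^sup>+\<sigma>. ennreal ((norm (msqrt (W x) *v haar_multiplier \<sigma> f x))\<^sup>2) \<partial>random_signs)"


section \<open>The sparse square function\<close>

definition sparse_coeff ::
    "(real \<Rightarrow> complex ^ 'd ^ 'd) \<Rightarrow> (real \<Rightarrow> complex ^ 'd) \<Rightarrow> real set \<Rightarrow> real" where
  "sparse_coeff W f I = average (\<lambda>x. norm (msqrt (average W I) *v f x)) I"

end

theory Submission
  imports Defs
begin

text \<open>Write \<open>c\<^sub>I\<close> for the Haar coefficients of \<open>f\<close> and \<open>\<langle>W\<rangle>\<^sub>I\<close> for the averages of \<open>W\<close>. Two estimates give the theorem:
  the squared norm of the square function is at most \<open>\<Sum>I. \<langle>\<langle>W\<rangle>\<^sub>I c\<^sub>I, c\<^sub>I\<rangle>\<close>, and this sum is at most a constant times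
  the sparse sum.

  For the second estimate, choose stopping intervals from the top down. Inside a stopping interval \<open>Q\<close> consider
  the rescaled function \<open>g = \<langle>W\<rangle>\<^sub>Q\<^sup>1\<^sup>/\<^sup>2 f\<close>, and stop at the maximal dyadic \<open>L\<close> for which the average of \<open>\<bar>g\<bar>\<close> over \<open>L\<close>
  exceeds \<open>M\<close> times that over \<open>Q\<close>, or for which \<open>\<langle>\<langle>W\<rangle>\<^sub>L u, u\<rangle>\<close> exceeds \<open>M \<langle>\<langle>W\<rangle>\<^sub>Q u, u\<rangle>\<close> for one of the \<open>d\<close> vectors \<open>u\<close> of
  a basis orthonormal for the form of \<open>\<langle>W\<rangle>\<^sub>Q\<close>. These are \<open>d + 1\<close> conditions, each of which stops at most the fraction
  \<open>1 / M\<close> of \<open>Q\<close>. With \<open>M = 2 (d + 1)\<close> at least half of \<open>Q\<close> remains, and the stopping intervals are sparse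
  (\<open>sparse_principal\<close>).

  Every dyadic \<open>I\<close> belongs to the block of exactly one \<open>Q\<close>, the smallest stopping interval containing it. In this
  block \<open>\<langle>W\<rangle>\<^sub>I \<le> d M \<langle>W\<rangle>\<^sub>Q\<close> (\<open>psd_test_vectors\<close>), so \<open>\<langle>\<langle>W\<rangle>\<^sub>I c\<^sub>I, c\<^sub>I\<rangle>\<close> is at most \<open>d M\<close> times the squared Haar
  coefficient of \<open>g\<close> (\<open>haar_energy_block\<close>). The averages of \<open>\<bar>g\<bar>\<close> on the block are at most \<open>M a\<close>, where \<open>a\<close> is the
  average on \<open>Q\<close>. The squared Haar coefficients are the increments of \<open>\<bar>I\<bar> \<bar>\<langle>g\<rangle>\<^sub>I\<bar>\<^sup>2\<close> under halving, so their sum over the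
  block telescopes and is at most \<open>2 M a\<^sup>2 \<bar>Q\<bar>\<close> (\<open>rescaled_block_bound\<close>). Summing over \<open>Q\<close> gives the constant
  \<open>2 d M\<^sup>2\<close>. Both the sparsity and this bound are instances of one statement about potentials on the tree,
  \<open>block_potential\<close>.

  The first estimate is trivial if \<open>\<Sum>I. \<langle>\<langle>W\<rangle>\<^sub>I c\<^sub>I, c\<^sub>I\<rangle>\<close> is infinite. Otherwise, at almost every \<open>x\<close>, the terms of the random
  Haar series multiplied by \<open>W(x)\<^sup>1\<^sup>/\<^sup>2\<close> are square summable, so the series converges for almost all signs, and Fatou's
  lemma bounds its second moment (\<open>AE_summable_random_signs\<close>, \<open>nn_integral_random_signs_le\<close>).

  The square root of a positive semidefinite matrix is defined by its characterizing property, so its existence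
  and uniqueness are derived from the spectral theorem (\<open>psd_root_exists_unique\<close>).\<close>

section \<open>Square roots of positive semidefinite matrices\<close>

lemma inner_eq_Re_cdot: "v \<bullet> w = Re (cdot v w)"
  by (simp add: cdot_def inner_vec_def inner_complex_def)

lemma cdot_self: "cdot v v = complex_of_real ((norm v)\<^sup>2)"
proof -
  have "(norm v)\<^sup>2 = (\<Sum>i\<in>UNIV. (norm (v $ i))\<^sup>2)"
    unfolding norm_vec_def L2_set_def by (simp add: sum_nonneg)
  then show ?thesis
    by (simp add: cdot_def flip: complex_norm_square)
qed

lemma norm_power2_eq_cdot: "(norm v)\<^sup>2 = Re (cdot v v)"
  by (simp add: cdot_self)

lemma cdot_simps:
  "cdot (v + w) z = cdot v z + cdot w z"
  "cdot (v - w) z = cdot v z - cdot w z"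
  "cdot (c *s v) z = c * cdot v z"
  "cdot (r *\<^sub>R v) z = r *\<^sub>R cdot v z"
  "cdot 0 z = 0"
  "cdot z (v + w) = cdot z v + cdot z w"
  "cdot z (v - w) = cdot z v - cdot z w"
  "cdot z (c *s v) = cnj c * cdot z v"
  "cdot z (r *\<^sub>R v) = r *\<^sub>R cdot z v"
  "cdot z 0 = 0"
  by (simp_all add: cdot_def algebra_simps sum.distrib sum_subtractf sum_distrib_left scaleR_sum_right)

lemma cdot_sum_left: "cdot (\<Sum>i\<in>S. v i) z = (\<Sum>i\<in>S. cdot (v i) z)"
  by (induction S rule: infinite_finite_induct) (auto simp: cdot_simps)

lemma cdot_commute: "cdot w v = cnj (cdot v w)"
  by (simp add: cdot_def mult.commute)

lemma cdot_hermitian: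
  assumes "hermitian A"
  shows "cdot (A *v v) w = cdot v (A *v w)"
proof -
  have "cdot (A *v v) w = (\<Sum>i\<in>UNIV. \<Sum>j\<in>UNIV. A $ i $ j * v $ j * cnj (w $ i))"
    by (simp add: cdot_def matrix_vector_mult_def sum_distrib_right)
  also have "\<dots> = (\<Sum>j\<in>UNIV. \<Sum>i\<in>UNIV. A $ i $ j * v $ j * cnj (w $ i))"
    by (rule sum.swap)
  also have "\<dots> = (\<Sum>j\<in>UNIV. \<Sum>i\<in>UNIV. v $ j * cnj (A $ j $ i * w $ i))"
  proof (intro sum.cong refl)
    fix i j
    have "A $ i $ j = cnj (A $ j $ i)"
      using assms unfolding hermitian_def by blast
    then show "A $ i $ j * v $ j * cnj (w $ i) = v $ j * cnj (A $ j $ i * w $ i)"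
      by (simp only: complex_cnj_mult mult_ac)
  qed
  also have "\<dots> = cdot v (A *v w)"
    by (simp add: cdot_def matrix_vector_mult_def sum_distrib_left)
  finally show ?thesis .
qed

lemma inner_hermitian:
  assumes "hermitian A"
  shows "(A *v v) \<bullet> w = v \<bullet> (A *v w)"
  using cdot_hermitian[OF assms] by (simp add: inner_eq_Re_cdot)

lemma linear_matrix_vector_mult: "linear ((*v) A)" for A :: "complex ^ 'n ^ 'm"
  by (rule linearI)
     (simp_all add: vec_eq_iff matrix_vector_mult_def algebra_simps sum.distrib scaleR_sum_right)

lemma scaleR_eq_vector_scale: "r *\<^sub>R v = complex_of_real r *s v"
  by (simp add: vec_eq_iff scaleR_conv_of_real[where 'a = complex])

text \<open>A maximizer of the quadratic form \<open>\<langle>f v, v\<rangle>\<close> on the unit sphere of an invariant subspace is an eigenvector.\<close>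

lemma selfadjoint_eigenvector:
  fixes f :: "'a::euclidean_space \<Rightarrow> 'a"
  assumes lin: "linear f" and sa: "\<And>x y. f x \<bullet> y = x \<bullet> f y"
    and V: "subspace V" and inv: "\<And>x. x \<in> V \<Longrightarrow> f x \<in> V" and ne: "z \<in> V" "z \<noteq> 0"
  obtains u l where "u \<in> V" "norm u = 1" "f u = l *\<^sub>R u"
proof -
  let ?K = "V \<inter> sphere 0 1"
  have "compact ?K"
    using closed_subspace[OF V] by (simp add: closed_Int_compact)
  moreover have "(1 / norm z) *\<^sub>R z \<in> ?K"
    using V ne by (simp add: subspace_scale)
  moreover have "continuous_on ?K (\<lambda>x. f x \<bullet> x)"
    using lin by (intro continuous_intros linear_continuous_on linear_conv_bounded_linear[THEN iffD1])
  ultimately obtain u where u: "u \<in> ?K" and max: "\<And>y. y \<in> ?K \<Longrightarrow> f y \<bullet> y \<le> f u \<bullet> u"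
    using continuous_attains_sup[of ?K "\<lambda>x. f x \<bullet> x"] by blast
  define l where "l = f u \<bullet> u"
  have uu: "u \<bullet> u = 1"
    using u by (simp add: dot_square_norm)
  have nonneg: "0 \<le> l * (v \<bullet> v) - f v \<bullet> v" if "v \<in> V" for v
  proof (cases "v = 0")
    case False
    have "(1 / norm v) *\<^sub>R v \<in> ?K"
      using V that False by (simp add: subspace_scale)
    from max[OF this] have "(f v \<bullet> v) / (norm v)\<^sup>2 \<le> l"
      by (simp add: l_def linear_scale[OF lin] power2_eq_square)
    then show ?thesis
      using False by (simp add: divide_le_eq dot_square_norm split: if_splits)
  qed (simp add: linear_0[OF lin])
  define w where "w = l *\<^sub>R u - f u"
  have w: "w \<in> V"
    unfolding w_def using u V inv by (simp add: subspace_diff subspace_scale)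
  \<comment> \<open>the form \<open>l\<bar>v\<bar>\<^sup>2 - \<langle>f v, v\<rangle>\<close> is minimal at \<open>u\<close>, so its first variation along \<open>w\<close> vanishes\<close>
  define q where "q = l * (w \<bullet> w) - f w \<bullet> w"
  have var: "0 \<le> 2 * t * (w \<bullet> w) + t\<^sup>2 * q" for t
  proof -
    have "u + t *\<^sub>R w \<in> V"
      using u w V by (simp add: subspace_add subspace_scale)
    from nonneg[OF this] have
      "0 \<le> l * ((u + t *\<^sub>R w) \<bullet> (u + t *\<^sub>R w)) - f (u + t *\<^sub>R w) \<bullet> (u + t *\<^sub>R w)" .
    also have "\<dots> = (l * (u \<bullet> u) - f u \<bullet> u) + 2 * t * (l * (u \<bullet> w) - f u \<bullet> w) + t\<^sup>2 * q"
      using sa[of w u]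
      by (simp add: linear_add[OF lin] linear_scale[OF lin] q_def inner_add_left inner_add_right
          inner_commute algebra_simps power2_eq_square)
    also have "l * (u \<bullet> w) - f u \<bullet> w = w \<bullet> w"
      by (simp add: w_def inner_diff_left)
    finally show ?thesis
      using uu by (simp add: l_def)
  qed
  have "w \<bullet> w = 0"
  proof (rule ccontr)
    assume "w \<bullet> w \<noteq> 0"
    then have pos: "0 < w \<bullet> w" by simp
    define t where "t = - (w \<bullet> w) / (\<bar>q\<bar> + 1)"
    have "t < 0" using pos by (simp add: t_def divide_neg_pos)
    have "\<bar>t * q\<bar> \<le> w \<bullet> w"
      using pos by (simp add: t_def abs_mult field_simps)
    then have "0 < 2 * (w \<bullet> w) + t * q" using pos by linarith
    with \<open>t < 0\<close> have "t * (2 * (w \<bullet> w) + t * q) < 0"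
      by (simp add: mult_neg_pos)
    with var[of t] show False by (simp add: algebra_simps power2_eq_square)
  qed
  then have "f u = l *\<^sub>R u" by (simp add: w_def)
  with u show ?thesis using that by auto
qed

lemma hermitian_diff: "hermitian A \<Longrightarrow> hermitian B \<Longrightarrow> hermitian (A - B)"
  unfolding hermitian_def vector_minus_component complex_cnj_diff
proof (intro allI)
  fix i j
  assume "\<forall>i j. A $ i $ j = cnj (A $ j $ i)" "\<forall>i j. B $ i $ j = cnj (B $ j $ i)"
  then have "A $ i $ j = cnj (A $ j $ i)" "B $ i $ j = cnj (B $ j $ i)"
    by blast+
  then show "A $ i $ j - B $ i $ j = cnj (A $ j $ i) - cnj (B $ j $ i)"
    by (rule arg_cong2)
qed

text \<open>The orthonormal families of eigenvectors have bounded cardinality. In the orthogonal complement of a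
  largest one, which is invariant, there is no further eigenvector, so the complement is trivial. The last
  conjunct expresses that \<open>E\<close> spans the space without expanding vectors in \<open>E\<close>.\<close>

lemma hermitian_eigenbasis:
  fixes A :: "complex ^ 'd ^ 'd"
  assumes A: "hermitian A"
  shows "\<exists>E l. finite E \<and> (\<forall>u\<in>E. cdot u u = 1) \<and>
      (\<forall>u\<in>E. \<forall>v\<in>E. u \<noteq> v \<longrightarrow> cdot u v = 0) \<and>
      (\<forall>u\<in>E. A *v u = complex_of_real (l u) *s u) \<and>
      (\<forall>v. (\<forall>u\<in>E. cdot v u = 0) \<longrightarrow> v = 0)"
proof -
  define P where "P E \<longleftrightarrow> finite E \<and> (\<forall>u\<in>E. cdot u u = 1) \<and>
      (\<forall>u\<in>E. \<forall>v\<in>E. u \<noteq> v \<longrightarrow> cdot u v = 0) \<and>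
      (\<forall>u\<in>E. \<exists>l. A *v u = complex_of_real l *s u)" for E
  have bound: "card E < Suc (DIM(complex ^ 'd))" if "P E" for E
  proof -
    have "pairwise orthogonal E"
      using that unfolding P_def pairwise_def orthogonal_def by (auto simp: inner_eq_Re_cdot)
    moreover have "0 \<notin> E"
      using that unfolding P_def by (auto simp: cdot_simps)
    ultimately have "independent E"
      by (rule pairwise_orthogonal_independent)
    then have "card E \<le> DIM(complex ^ 'd)"
      by (rule independent_bound[THEN conjunct2])
    then show ?thesis by simp
  qed
  have "P {}" by (simp add: P_def)
  then obtain E where E: "P E" and max: "\<And>F. P F \<Longrightarrow> card F \<le> card E"
    using ex_has_greatest_nat[of P "{}" card "Suc (DIM(complex ^ 'd))"] bound by (auto simp: less_imp_le)
  have complete: "v = 0" if v: "\<And>u. u \<in> E \<Longrightarrow> cdot v u = 0" for v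
  proof (rule ccontr)
    assume "v \<noteq> 0"
    define V where "V = {x. \<forall>u\<in>E. cdot x u = 0}"
    have "subspace V"
      by (auto simp: V_def subspace_def cdot_simps)
    moreover have "A *v x \<in> V" if "x \<in> V" for x
      using that E unfolding V_def P_def
      by (fastforce simp: cdot_hermitian[OF A] cdot_simps)
    moreover have "v \<in> V" using v by (simp add: V_def)
    ultimately obtain w l where w: "w \<in> V" "norm w = 1" "A *v w = l *\<^sub>R w"
      using selfadjoint_eigenvector[OF linear_matrix_vector_mult[of A] inner_hermitian[OF A], of V v]
        \<open>v \<noteq> 0\<close> by metis
    have "cdot w w = 1" using w(2) by (simp add: cdot_self)
    then have "w \<notin> E" using w(1) by (auto simp: V_def)
    moreover have "P (insert w E)"
      unfolding P_def
    proof (intro conjI ballI impI)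
      fix x y assume "x \<in> insert w E" "y \<in> insert w E" "x \<noteq> y"
      then show "cdot x y = 0"
        using E w(1) cdot_commute[of w] unfolding P_def V_def by auto
    qed (use E w \<open>cdot w w = 1\<close> in \<open>auto simp: P_def scaleR_eq_vector_scale\<close>)
    ultimately show False
      using max[of "insert w E"] E by (simp add: P_def)
  qed
  have "\<forall>u\<in>E. \<exists>l. A *v u = complex_of_real l *s u"
    using E unfolding P_def by (elim conjE)
  from bchoice[OF this] obtain l where l: "\<forall>u\<in>E. A *v u = complex_of_real (l u) *s u"
    by (elim exE)
  show ?thesis
  proof (intro exI[of _ E] exI[of _ l] conjI ballI allI impI)
    fix v assume "\<forall>u\<in>E. cdot v u = 0"
    then show "v = 0" using complete by simp
  qed (use E l in \<open>auto simp: P_def\<close>)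
qed

text \<open>For \<open>u \<in> E\<close> the product \<open>\<langle>(A - B) v, u\<rangle> = \<langle>v, (A - B) u\<rangle>\<close> vanishes, so the range of \<open>A - B\<close> is orthogonal
  to \<open>E\<close>.\<close>

lemma hermitian_eqI:
  assumes "hermitian A" "hermitian B"
    and agree: "\<And>u. u \<in> E \<Longrightarrow> A *v u = B *v u"
    and complete: "\<And>v. (\<And>u. u \<in> E \<Longrightarrow> cdot v u = 0) \<Longrightarrow> v = 0"
  shows "A = B"
proof -
  have "(A - B) *v u = 0" if "u \<in> E" for u
    using agree[OF that] by (simp add: matrix_vector_mult_diff_rdistrib)
  then have "(A - B) *v v = 0" for v
    by (intro complete)
      (simp add: cdot_hermitian[OF hermitian_diff[OF assms(1,2)]] cdot_simps(10))
  then show ?thesis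
    by (simp add: matrix_eq matrix_vector_mult_diff_rdistrib)
qed

lemma psd_Re_nonneg: "psd A \<Longrightarrow> 0 \<le> Re (cdot (A *v v) v)"
  by (simp add: psd_def)

lemma hermitian_square:
  assumes "hermitian B" shows "hermitian (B ** B)"
  unfolding hermitian_def
proof (intro allI)
  fix i j
  have "(\<Sum>k\<in>UNIV. B $ i $ k * B $ k $ j) = (\<Sum>k\<in>UNIV. cnj (B $ j $ k * B $ k $ i))"
  proof (rule sum.cong[OF refl])
    fix k
    have "B $ i $ k = cnj (B $ k $ i)" "B $ k $ j = cnj (B $ j $ k)"
      using assms unfolding hermitian_def by blast+
    then show "B $ i $ k * B $ k $ j = cnj (B $ j $ k * B $ k $ i)"
      by (simp only: complex_cnj_mult mult_ac)
  qed
  then show "(B ** B) $ i $ j = cnj ((B ** B) $ j $ i)"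
    by (simp add: matrix_matrix_mult_def)
qed

text \<open>Let \<open>w = B u - \<surd>l u\<close>; then \<open>B w = - \<surd>l w\<close>, so \<open>\<langle>B w, w\<rangle> \<ge> 0\<close> forces \<open>w = 0\<close> if \<open>l > 0\<close>. If \<open>l = 0\<close>,
  then \<open>\<bar>B u\<bar>\<^sup>2 = \<langle>A u, u\<rangle> = 0\<close>. Hence the values of a positive semidefinite root on a complete set of
  eigenvectors of \<open>A\<close> are determined by \<open>A\<close>, which gives uniqueness of the root.\<close>

lemma psd_root_eigenvector:
  assumes B: "psd B" and sq: "B ** B = A" and u: "A *v u = complex_of_real l *s u" and l: "0 \<le> l"
  shows "B *v u = complex_of_real (sqrt l) *s u"
proof -
  define r where "r = sqrt l"
  have r: "0 \<le> r" "complex_of_real l = complex_of_real r * complex_of_real r"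
    using l by (simp_all add: r_def flip: of_real_mult)
  have herm: "hermitian B" using B by (simp add: psd_def)
  define w where "w = B *v u - complex_of_real r *s u"
  have BB: "B *v (B *v u) = complex_of_real r *s (complex_of_real r *s u)"
    using u sq r(2) by (simp add: matrix_vector_mul_assoc vector_smult_assoc)
  have Bw: "B *v w = - (r *\<^sub>R w)"
    unfolding w_def scaleR_eq_vector_scale
    by (simp add: matrix_vector_mult_diff_distrib BB vector_scalar_commute vector_ssub_ldistrib)
  have "w = 0"
  proof (cases "r = 0")
    case True
    have "cdot w w = cdot (B *v (B *v u)) u"
      unfolding w_def True by (simp add: cdot_hermitian[OF herm])
    then have "cdot w w = 0"
      by (simp add: BB True cdot_simps)
    then show ?thesis by (simp add: cdot_self)
  next
    case False
    have "0 \<le> (B *v w) \<bullet> w"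
      using B by (simp add: psd_def inner_eq_Re_cdot)
    then have "r * (w \<bullet> w) \<le> 0" by (simp add: Bw)
    then have "w \<bullet> w \<le> 0" using r(1) False by (simp add: mult_le_0_iff)
    then show ?thesis by (metis inner_eq_zero_iff inner_ge_zero order_antisym)
  qed
  then show ?thesis by (simp add: w_def r_def)
qed

lemma psd_root_exists_unique:
  fixes A :: "complex ^ 'd ^ 'd"
  assumes A: "psd A"
  shows "\<exists>!B. psd B \<and> B ** B = A"
proof -
  have herm: "hermitian A" using A by (simp add: psd_def)
  from hermitian_eigenbasis[OF herm] obtain E l where fin: "finite E"
    and one': "\<forall>u\<in>E. cdot u u = 1"
    and orth': "\<forall>u\<in>E. \<forall>v\<in>E. u \<noteq> v \<longrightarrow> cdot u v = 0"
    and eig': "\<forall>u\<in>E. A *v u = complex_of_real (l u) *s u"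
    and complete': "\<forall>v. (\<forall>u\<in>E. cdot v u = 0) \<longrightarrow> v = 0"
    by (elim exE conjE)
  note one = bspec[OF one'] and orth = orth'[rule_format] and eig = bspec[OF eig']
    and complete = complete'[rule_format]
  have l: "0 \<le> l u" if "u \<in> E" for u
    using psd_Re_nonneg[OF A, of u] by (simp add: eig that one cdot_simps)
  define B :: "complex ^ 'd ^ 'd" where
    "B = (\<chi> i j. \<Sum>u\<in>E. complex_of_real (sqrt (l u)) * u $ i * cnj (u $ j))"
  have Bv: "B *v v = (\<Sum>u\<in>E. (complex_of_real (sqrt (l u)) * cdot v u) *s u)" for v
  proof -
    have "(B *v v) $ i = (\<Sum>u\<in>E. (complex_of_real (sqrt (l u)) * cdot v u) *s u) $ i" for i
      unfolding B_def matrix_vector_mult_def cdot_def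
      by (simp add: sum_distrib_right sum_distrib_left sum.swap[of _ UNIV E] mult_ac)
    then show ?thesis by (simp add: vec_eq_iff)
  qed
  have hermB: "hermitian B"
    by (simp add: hermitian_def B_def mult_ac)
  have "0 \<le> Re (cdot (B *v v) v)" for v
  proof -
    have "cdot (B *v v) v = (\<Sum>u\<in>E. complex_of_real (sqrt (l u)) * (cdot v u * cnj (cdot v u)))"
      unfolding Bv cdot_sum_left by (simp add: cdot_simps mult_ac flip: cdot_commute)
    also have "Re \<dots> = (\<Sum>u\<in>E. sqrt (l u) * (norm (cdot v u))\<^sup>2)"
      by (simp flip: complex_norm_square of_real_mult of_real_power)
    finally show ?thesis by (simp add: sum_nonneg l)
  qed
  then have B: "psd B" using hermB by (simp add: psd_def)
  have Bu: "B *v u = complex_of_real (sqrt (l u)) *s u" if "u \<in> E" for u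
  proof -
    have "(complex_of_real (sqrt (l w)) * cdot u w) *s w
        = (if w = u then complex_of_real (sqrt (l u)) *s u else 0)" if "w \<in> E" for w
      using orth[OF \<open>u \<in> E\<close> that] one[OF that] by auto
    then show ?thesis
      unfolding Bv using fin that by (simp add: sum.delta')
  qed
  have BB: "B ** B = A"
  proof (rule hermitian_eqI[OF hermitian_square[OF hermB] herm _ complete])
    fix u assume u: "u \<in> E"
    have "complex_of_real (sqrt (l u)) * complex_of_real (sqrt (l u)) = complex_of_real (l u)"
      using l[OF u] by (simp flip: of_real_mult)
    then show "(B ** B) *v u = A *v u"
      using u by (simp add: Bu eig vector_scalar_commute vector_smult_assoc flip: matrix_vector_mul_assoc)
  qed
  show ?thesis
  proof (rule ex1I[of _ B])
    fix C assume C: "psd C \<and> C ** C = A"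
    show "C = B"
    proof (rule hermitian_eqI[OF _ hermB _ complete])
      fix u assume "u \<in> E"
      then show "C *v u = B *v u"
        using psd_root_eigenvector[of C A u "l u"] C eig l Bu by simp
    qed (use C in \<open>simp add: psd_def\<close>)
  qed (use B BB in simp)
qed

lemma psd_msqrt: "psd A \<Longrightarrow> psd (msqrt A)"
  and msqrt_square: "psd A \<Longrightarrow> msqrt A ** msqrt A = A"
  unfolding msqrt_def using theI'[OF psd_root_exists_unique] by blast+

lemma norm_msqrt:
  assumes "psd A"
  shows "(norm (msqrt A *v v))\<^sup>2 = Re (cdot (A *v v) v)"
proof -
  have "hermitian (msqrt A)" using psd_msqrt[OF assms] by (simp add: psd_def)
  then have "cdot (msqrt A *v v) (msqrt A *v v) = cdot ((msqrt A ** msqrt A) *v v) v"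
    by (simp add: cdot_hermitian flip: matrix_vector_mul_assoc)
  then show ?thesis by (simp add: norm_power2_eq_cdot msqrt_square assms)
qed

lemma psd_invertible_pos:
  assumes "psd A" "invertible A" "v \<noteq> 0"
  shows "0 < Re (cdot (A *v v) v)"
proof -
  have "A *v v \<noteq> 0"
    using assms(2,3) by (metis invertible_def matrix_vector_mul_assoc matrix_vector_mul_lid matrix_vector_mult_0_right)
  moreover have "A *v v = msqrt A *v (msqrt A *v v)"
    by (simp add: matrix_vector_mul_assoc msqrt_square[OF assms(1)])
  ultimately have "msqrt A *v v \<noteq> 0" by auto
  then have "0 < (norm (msqrt A *v v))\<^sup>2" by simp
  then show ?thesis by (simp only: norm_msqrt[OF assms(1)])
qed

lemma msqrt_left_inverse:
  fixes A :: "complex ^ 'd ^ 'd"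
  assumes A: "psd A" and pos: "\<And>v. v \<noteq> 0 \<Longrightarrow> 0 < Re (cdot (A *v v) v)"
  obtains R where "R ** msqrt A = mat 1"
proof -
  have "inj ((*v) (msqrt A))"
  proof (rule injI)
    fix x y assume "msqrt A *v x = msqrt A *v y"
    then have "msqrt A *v (x - y) = 0" by (simp add: matrix_vector_mult_diff_distrib)
    then have "Re (cdot (A *v (x - y)) (x - y)) = 0"
      by (simp flip: norm_msqrt[OF A])
    then show "x = y" using pos[of "x - y"] by force
  qed
  then show ?thesis using that matrix_left_invertible_injective by metis
qed

text \<open>The vectors \<open>u i\<close> are the columns of the inverse of \<open>B = msqrt A\<close>. They are orthonormal for the form of
  \<open>A\<close>, and \<open>v\<close> has the coordinates \<open>B v\<close> with respect to them. By the triangle inequality for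
  \<open>\<bar>msqrt L v\<bar>\<close> and the Cauchy-Schwarz inequality, testing the form of \<open>L\<close> on these \<open>d\<close> vectors controls it
  on all vectors, with the loss of a factor \<open>d\<close>.\<close>

lemma psd_test_vectors:
  fixes A :: "complex ^ 'd ^ 'd"
  assumes A: "psd A" and pos: "\<And>v. v \<noteq> 0 \<Longrightarrow> 0 < Re (cdot (A *v v) v)"
  obtains u :: "'d \<Rightarrow> complex ^ 'd" where
    "\<And>i. Re (cdot (A *v u i) (u i)) = 1"
    "\<And>L M v. psd L \<Longrightarrow> (\<And>i. Re (cdot (L *v u i) (u i)) \<le> M) \<Longrightarrow>
       Re (cdot (L *v v) v) \<le> real CARD('d) * M * Re (cdot (A *v v) v)"
proof -
  define B where "B = msqrt A"
  obtain R where RB: "R ** B = mat 1"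
    using msqrt_left_inverse[OF A pos] B_def by metis
  then have BR: "B ** R = mat 1" by (simp add: matrix_left_right_inverse)
  define u where "u i = R *v axis i 1" for i
  have normA: "Re (cdot (A *v v) v) = (norm (B *v v))\<^sup>2" for v
    by (simp add: B_def norm_msqrt[OF A])
  have 1: "Re (cdot (A *v u i) (u i)) = 1" for i
  proof -
    have "norm (axis i (1 :: complex)) = 1"
      by (rule norm_Basis) (simp add: axis_in_Basis_iff)
    then show ?thesis
      unfolding normA by (simp add: u_def matrix_vector_mul_assoc BR)
  qed
  have expand: "v = (\<Sum>i\<in>UNIV. (B *v v) $ i *s u i)" for v
  proof -
    have "v = R *v (B *v v)" by (simp add: matrix_vector_mul_assoc RB)
    also have "\<dots> = R *v (\<Sum>i\<in>UNIV. (B *v v) $ i *s axis i 1)" by (simp add: basis_expansion)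
    also have "\<dots> = (\<Sum>i\<in>UNIV. (B *v v) $ i *s u i)"
      by (simp add: u_def vector_scalar_commute linear_sum[OF linear_matrix_vector_mult])
    finally show ?thesis .
  qed
  have 2: "Re (cdot (L *v v) v) \<le> real CARD('d) * M * Re (cdot (A *v v) v)"
    if L: "psd L" and le: "\<And>i. Re (cdot (L *v u i) (u i)) \<le> M" for L M v
  proof -
    have "0 \<le> M" using le[of undefined] psd_Re_nonneg[OF L, of "u undefined"] by linarith
    define c where "c i = norm ((B *v v) $ i)" for i
    have Lu: "norm (msqrt L *v u i) \<le> sqrt M" for i
      using le[of i] by (simp add: real_le_rsqrt flip: norm_msqrt[OF L])
    have "norm (msqrt L *v v) = norm (\<Sum>i\<in>UNIV. (B *v v) $ i *s (msqrt L *v u i))"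
      by (subst expand) (simp add: linear_sum[OF linear_matrix_vector_mult] vector_scalar_commute)
    also have "\<dots> \<le> (\<Sum>i\<in>UNIV. norm ((B *v v) $ i *s (msqrt L *v u i)))"
      by (rule norm_sum)
    also have "\<dots> \<le> (\<Sum>i\<in>UNIV. c i * sqrt M)"
    proof (rule sum_mono)
      fix i
      have "norm (z *s x) = norm z * norm x" for z and x :: "complex ^ 'd"
        by (simp add: norm_vec_def norm_mult L2_set_right_distrib)
      then show "norm ((B *v v) $ i *s (msqrt L *v u i)) \<le> c i * sqrt M"
        by (simp add: c_def Lu mult_left_mono)
    qed
    finally have "(norm (msqrt L *v v))\<^sup>2 \<le> (\<Sum>i\<in>UNIV. c i * sqrt M)\<^sup>2"
      by (rule power_mono) simp
    also have "\<dots> = M * (\<Sum>i\<in>UNIV. c i)\<^sup>2"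
      using \<open>0 \<le> M\<close> by (simp add: power_mult_distrib flip: sum_distrib_right)
    also have "\<dots> \<le> M * (real CARD('d) * (\<Sum>i\<in>UNIV. (c i)\<^sup>2))"
      using \<open>0 \<le> M\<close> sum_squared_le_sum_of_squares[of c UNIV]
      by (intro mult_left_mono) (simp_all add: mult.commute)
    also have "(\<Sum>i\<in>UNIV. (c i)\<^sup>2) = (norm (B *v v))\<^sup>2"
      by (simp add: c_def norm_vec_def L2_set_def sum_nonneg)
    finally show ?thesis
      by (simp add: norm_msqrt[OF L] normA mult_ac)
  qed
  show ?thesis using that 1 2 by blast
qed

lemma invertible_right_inverse: "invertible A \<Longrightarrow> A ** matrix_inv A = mat 1"
  unfolding invertible_def matrix_inv_def by (rule someI2_ex) auto

text \<open>With \<open>B = msqrt A\<close>, the inner product is that of \<open>B v\<close> and the vector \<open>B (matrix_inv A *v a)\<close>, whose squared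
  norms are the terms on the right. If \<open>A\<close> runs through the values of a weight with integrable inverse and \<open>v\<close>
  through those of a function in the weighted space, both are integrable, hence so is the function.\<close>

lemma inner_le_form_inverse:
  fixes A :: "complex ^ 'd ^ 'd"
  assumes A: "psd A" and inv: "invertible A"
  shows "2 * \<bar>v \<bullet> a\<bar> \<le> Re (cdot (A *v v) v) + Re (cdot (matrix_inv A *v a) a)"
proof -
  define w where "w = matrix_inv A *v a"
  have herm: "hermitian A" "hermitian (msqrt A)"
    using A psd_msqrt[OF A] by (simp_all add: psd_def)
  have Aw: "A *v w = a"
    by (simp add: w_def matrix_vector_mul_assoc invertible_right_inverse[OF inv])
  have "v \<bullet> a = (msqrt A *v v) \<bullet> (msqrt A *v w)"
    by (simp add: inner_hermitian[OF herm(2)] matrix_vector_mul_assoc msqrt_square[OF A] Aw)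
  then have "\<bar>v \<bullet> a\<bar> \<le> norm (msqrt A *v v) * norm (msqrt A *v w)"
    by (simp add: Cauchy_Schwarz_ineq2)
  moreover have "2 * (norm (msqrt A *v v) * norm (msqrt A *v w))
      \<le> (norm (msqrt A *v v))\<^sup>2 + (norm (msqrt A *v w))\<^sup>2"
    using sum_squares_bound[of "norm (msqrt A *v v)" "norm (msqrt A *v w)"] by simp
  moreover have "Re (cdot (A *v w) w) = Re (cdot (matrix_inv A *v a) a)"
    using Aw by (simp add: w_def inner_commute flip: inner_eq_Re_cdot)
  ultimately show ?thesis by (simp add: norm_msqrt[OF A])
qed

section \<open>Series with random signs\<close>

definition signs :: "'i set \<Rightarrow> ('i \<Rightarrow> real) measure" where
  "signs D = (\<Pi>\<^sub>M i\<in>D. measure_pmf (pmf_of_set {-1, 1}))"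

lemma prob_space_signs: "prob_space (signs D)"
  unfolding signs_def by (intro prob_space_PiM measure_pmf.prob_space_axioms)

lemma measurable_sign [measurable]:
  assumes "i \<in> D" shows "(\<lambda>\<sigma>. \<sigma> i) \<in> borel_measurable (signs D)"
proof -
  have "(\<lambda>\<sigma>. \<sigma> i) \<in> measurable (signs D) (measure_pmf (pmf_of_set {-1, 1}))"
    unfolding signs_def by (rule measurable_component_singleton[OF assms])
  then show ?thesis
    by (rule measurable_compose) simp
qed

text \<open>Resampling one coordinate of a product measure leaves the measure unchanged. This is the only form in
  which independence of the signs enters.\<close>

lemma nn_integral_resample_sign:
  assumes F [measurable]: "F \<in> borel_measurable (signs D)" and i: "i \<in> D"
  shows "(\<integral>\<^sup>+\<sigma>. F \<sigma> \<partial>signs D)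
    = ((\<integral>\<^sup>+\<sigma>. F (\<sigma>(i := 1)) \<partial>signs D) + (\<integral>\<^sup>+\<sigma>. F (\<sigma>(i := - 1)) \<partial>signs D)) / 2"
proof -
  let ?P = "measure_pmf (pmf_of_set {-1, 1 :: real})"
  interpret signs: prob_space "signs D" by (rule prob_space_signs)
  have upd [measurable]: "(\<lambda>(x, X). X(i := x)) \<in> measurable (?P \<Otimes>\<^sub>M signs D) (signs D)"
    unfolding signs_def case_prod_beta
    by (rule measurable_fun_upd[where J = D]) (use i in auto)
  have "signs D = distr (?P \<Otimes>\<^sub>M signs D) (signs D) (\<lambda>(x, X). X(i := x))"
    using distr_pair_PiM_eq_PiM[of D "\<lambda>_. ?P" i] i
    by (simp add: signs_def insert_absorb measure_pmf.prob_space_axioms)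
  then have "(\<integral>\<^sup>+\<sigma>. F \<sigma> \<partial>signs D)
      = (\<integral>\<^sup>+\<sigma>. F \<sigma> \<partial>distr (?P \<Otimes>\<^sub>M signs D) (signs D) (\<lambda>(x, X). X(i := x)))"
    by simp
  also have "\<dots> = (\<integral>\<^sup>+p. F ((snd p)(i := fst p)) \<partial>(?P \<Otimes>\<^sub>M signs D))"
    by (subst nn_integral_distr) (simp_all add: case_prod_beta)
  also have "\<dots> = (\<integral>\<^sup>+x. \<integral>\<^sup>+X. F (X(i := x)) \<partial>signs D \<partial>?P)"
    using measurable_compose[OF upd F]
    by (subst signs.nn_integral_fst[symmetric]) (simp_all add: case_prod_beta)
  also have "\<dots> = ((\<integral>\<^sup>+\<sigma>. F (\<sigma>(i := 1)) \<partial>signs D) + (\<integral>\<^sup>+\<sigma>. F (\<sigma>(i := - 1)) \<partial>signs D)) / 2"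
    by (subst nn_integral_pmf_of_set) (auto simp: add.commute)
  finally show ?thesis .
qed

lemma ennreal_midpoint: "0 \<le> a \<Longrightarrow> 0 \<le> b \<Longrightarrow> (ennreal a + ennreal b) / 2 = ennreal ((a + b) / 2)"
  by (simp add: ennreal_numeral[symmetric] divide_ennreal del: ennreal_numeral ennreal_plus flip: ennreal_plus)

lemma norm_parallelogram: "((norm (s + z))\<^sup>2 + (norm (s - z))\<^sup>2) / 2 = (norm s)\<^sup>2 + (norm z)\<^sup>2"
  for s z :: "'b::real_inner"
  by (simp add: power2_norm_eq_inner inner_add inner_diff algebra_simps inner_commute)

context
  fixes D :: "'i set" and I :: "nat \<Rightarrow> 'i" and y :: "nat \<Rightarrow> 'b::euclidean_space"
  assumes I: "inj I" "range I \<subseteq> D"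
begin

abbreviation walk :: "'b \<Rightarrow> nat \<Rightarrow> nat \<Rightarrow> ('i \<Rightarrow> real) \<Rightarrow> 'b" where
  "walk s m n \<sigma> \<equiv> s + (\<Sum>k=m..<m + n. \<sigma> (I k) *\<^sub>R y k)"

lemma I_in: "I k \<in> D"
  using I(2) by auto

lemma walk_first_step: "walk s m (Suc n) (\<sigma>(I m := e)) = walk (s + e *\<^sub>R y m) (Suc m) n \<sigma>"
proof -
  have "(\<Sum>k=m..<m + Suc n. (\<sigma>(I m := e)) (I k) *\<^sub>R y k)
      = e *\<^sub>R y m + (\<Sum>k=Suc m..<m + Suc n. (\<sigma>(I m := e)) (I k) *\<^sub>R y k)"
    by (subst sum.atLeast_Suc_lessThan) auto
  also have "(\<Sum>k=Suc m..<m + Suc n. (\<sigma>(I m := e)) (I k) *\<^sub>R y k)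
      = (\<Sum>k=Suc m..<m + Suc n. \<sigma> (I k) *\<^sub>R y k)"
    by (intro sum.cong) (auto simp: inj_eq[OF I(1)])
  finally show ?thesis by (simp add: add.assoc)
qed

text \<open>By the parallelogram law, averaging over the first sign turns \<open>\<bar>s\<bar>\<^sup>2\<close> into \<open>\<bar>s\<bar>\<^sup>2 + \<bar>y m\<bar>\<^sup>2\<close>, for every starting
  point \<open>s\<close>. The general starting point makes the induction possible.\<close>

lemma walk_second_moment:
  "(\<integral>\<^sup>+\<sigma>. ennreal ((norm (walk s m n \<sigma>))\<^sup>2) \<partial>signs D)
    = ennreal ((norm s)\<^sup>2 + (\<Sum>k=m..<m + n. (norm (y k))\<^sup>2))"
proof (induction n arbitrary: s m)
  case 0
  interpret prob_space "signs D" by (rule prob_space_signs)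
  show ?case by (simp add: emeasure_space_1)
next
  case (Suc n)
  note I_in [simp, measurable]
  let ?r = "\<Sum>k=Suc m..<Suc m + n. (norm (y k))\<^sup>2"
  have "(\<integral>\<^sup>+\<sigma>. ennreal ((norm (walk s m (Suc n) \<sigma>))\<^sup>2) \<partial>signs D)
      = (ennreal ((norm (s + y m))\<^sup>2 + ?r) + ennreal ((norm (s - y m))\<^sup>2 + ?r)) / 2"
    by (subst nn_integral_resample_sign[where i = "I m"], measurable)
      (simp only: walk_first_step Suc.IH, simp)
  also have "\<dots> = ennreal ((norm s)\<^sup>2 + ((norm (y m))\<^sup>2 + ?r))"
  proof -
    have "((norm (s + y m))\<^sup>2 + ?r + ((norm (s - y m))\<^sup>2 + ?r)) / 2 = (norm s)\<^sup>2 + ((norm (y m))\<^sup>2 + ?r)"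
      using norm_parallelogram[of s "y m"] by (simp add: field_simps)
    note average = this
    show ?thesis
      unfolding average[symmetric]
      by (rule ennreal_midpoint) (intro add_nonneg_nonneg sum_nonneg zero_le_power2)+
  qed
  also have "(norm (y m))\<^sup>2 + ?r = (\<Sum>k=m..<m + Suc n. (norm (y k))\<^sup>2)"
    by (subst (2) sum.atLeast_Suc_lessThan) auto
  finally show ?case .
qed

text \<open>Kolmogorov's maximal inequality. If the starting point is already far away, the bound is at least 1.
  Otherwise reveal the first sign: what remains is the same event for a shorter walk from \<open>s + y m\<close> or
  \<open>s - y m\<close>, and by the parallelogram law the average of the two bounds is the bound claimed.\<close>

lemma walk_maximal_inequality:
  assumes r: "0 < r"
  shows "(\<integral>\<^sup>+\<sigma>. indicator {\<sigma>. \<exists>k\<le>n. r \<le> norm (walk s m k \<sigma>)} \<sigma> \<partial>signs D)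
    \<le> ennreal (((norm s)\<^sup>2 + (\<Sum>k=m..<m + n. (norm (y k))\<^sup>2)) / r\<^sup>2)"
proof -
  note I_in [simp, measurable]
  define ev where "ev n s m \<sigma> \<longleftrightarrow> (\<exists>k\<le>n. r \<le> norm (walk s m k \<sigma>))" for n s m \<sigma>
  define b where "b n s m = ((norm s)\<^sup>2 + (\<Sum>k=m..<m + n. (norm (y k))\<^sup>2)) / r\<^sup>2" for n and s :: 'b and m
  have b_nonneg: "0 \<le> b n s m" for n s m
    by (simp add: b_def sum_nonneg)
  have [measurable]: "Measurable.pred (signs D) (ev n s m)" for n s m
    unfolding ev_def by measurable
  have average: "((a + c) / q + (b + c) / q) / 2 = ((a + b) / 2 + c) / q" for a b c q :: real
    by (cases "q = 0") (simp_all add: field_simps)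
  have far: "(\<integral>\<^sup>+\<sigma>. indicator {\<sigma>. ev n s m \<sigma>} \<sigma> \<partial>signs D) \<le> ennreal (b n s m)"
    if "r \<le> norm s" for n s m
  proof -
    interpret prob_space "signs D" by (rule prob_space_signs)
    have "r\<^sup>2 \<le> (norm s)\<^sup>2 + (\<Sum>k=m..<m + n. (norm (y k))\<^sup>2)"
      using power_mono[OF that, of 2] r by (simp add: sum_nonneg add_increasing2)
    then have bound: "1 \<le> ennreal (b n s m)"
      using r by (simp add: b_def le_divide_eq)
    have "(\<integral>\<^sup>+\<sigma>. indicator {\<sigma>. ev n s m \<sigma>} \<sigma> \<partial>signs D) \<le> (\<integral>\<^sup>+\<sigma>. 1 \<partial>signs D)"
      by (intro nn_integral_mono) (simp add: indicator_def)
    also have "\<dots> = 1" by (simp add: emeasure_space_1)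
    finally show ?thesis using bound by (rule order_trans)
  qed
  have "(\<integral>\<^sup>+\<sigma>. indicator {\<sigma>. ev n s m \<sigma>} \<sigma> \<partial>signs D) \<le> ennreal (b n s m)" for n s m
  proof (induction n arbitrary: s m)
    case 0
    show ?case
    proof (cases "r \<le> norm s")
      case False
      then have "ev 0 s m \<sigma> \<longleftrightarrow> False" for \<sigma> by (simp add: ev_def)
      then show ?thesis by simp
    qed (rule far)
  next
    case (Suc n)
    show ?case
    proof (cases "r \<le> norm s")
      case False
      have step: "ev (Suc n) s m (\<sigma>(I m := e)) \<longleftrightarrow> ev n (s + e *\<^sub>R y m) (Suc m) \<sigma>" for \<sigma> e
      proof -
        have "ev (Suc n) s m (\<sigma>(I m := e)) \<longleftrightarrow> (\<exists>k\<le>n. r \<le> norm (walk s m (Suc k) (\<sigma>(I m := e))))"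
        proof
          assume "ev (Suc n) s m (\<sigma>(I m := e))"
          then obtain k where "k \<le> Suc n" "r \<le> norm (walk s m k (\<sigma>(I m := e)))"
            by (auto simp: ev_def)
          with False show "\<exists>k\<le>n. r \<le> norm (walk s m (Suc k) (\<sigma>(I m := e)))"
            by (cases k) auto
        qed (auto simp: ev_def intro: Suc_le_mono[THEN iffD2])
        then show ?thesis by (simp only: walk_first_step ev_def)
      qed
      have ind: "(indicator {\<sigma>. ev (Suc n) s m \<sigma>} (\<sigma>(I m := e)) :: ennreal)
          = indicator {\<sigma>. ev n (s + e *\<^sub>R y m) (Suc m) \<sigma>} \<sigma>" for \<sigma> e
        by (simp add: indicator_def step)
      have "(\<integral>\<^sup>+\<sigma>. indicator {\<sigma>. ev (Suc n) s m \<sigma>} \<sigma> \<partial>signs D)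
        = ((\<integral>\<^sup>+\<sigma>. indicator {\<sigma>. ev n (s + y m) (Suc m) \<sigma>} \<sigma> \<partial>signs D)
          + (\<integral>\<^sup>+\<sigma>. indicator {\<sigma>. ev n (s - y m) (Suc m) \<sigma>} \<sigma> \<partial>signs D)) / 2"
        by (subst nn_integral_resample_sign[where i = "I m"], measurable) (simp only: ind, simp)
      also have "\<dots> \<le> (ennreal (b n (s + y m) (Suc m)) + ennreal (b n (s - y m) (Suc m))) / 2"
        by (intro divide_right_mono_ennreal add_mono Suc.IH)
      also have "\<dots> = ennreal ((b n (s + y m) (Suc m) + b n (s - y m) (Suc m)) / 2)"
        by (rule ennreal_midpoint[OF b_nonneg b_nonneg])
      also have "(b n (s + y m) (Suc m) + b n (s - y m) (Suc m)) / 2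
          = (((norm (s + y m))\<^sup>2 + (norm (s - y m))\<^sup>2) / 2 + (\<Sum>k=Suc m..<Suc m + n. (norm (y k))\<^sup>2)) / r\<^sup>2"
        unfolding b_def by (rule average)
      also have "\<dots> = b (Suc n) s m"
        unfolding b_def norm_parallelogram by (subst (2) sum.atLeast_Suc_lessThan) (simp_all add: add_ac)
      finally show ?thesis .
    qed (rule far)
  qed
  then show ?thesis by (simp add: ev_def b_def)
qed

lemma walk_tail_inequality:
  assumes r: "0 < r" and y: "summable (\<lambda>k. (norm (y k))\<^sup>2)"
  shows "(\<integral>\<^sup>+\<sigma>. indicator {\<sigma>. \<exists>k. r \<le> norm (walk 0 m k \<sigma>)} \<sigma> \<partial>signs D)
    \<le> ennreal ((\<Sum>k. (norm (y (k + m)))\<^sup>2) / r\<^sup>2)"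
proof -
  note I_in [simp, measurable]
  have "indicator {\<sigma>. \<exists>k. r \<le> norm (walk 0 m k \<sigma>)} \<sigma>
      = (SUP n. indicator {\<sigma>. \<exists>k\<le>n. r \<le> norm (walk 0 m k \<sigma>)} \<sigma> :: ennreal)" for \<sigma>
  proof (cases "\<exists>k. r \<le> norm (walk 0 m k \<sigma>)")
    case True
    then obtain k where "r \<le> norm (walk 0 m k \<sigma>)" by blast
    then have "indicator {\<sigma>. \<exists>k'\<le>k. r \<le> norm (walk 0 m k' \<sigma>)} \<sigma> = (1 :: ennreal)"
      by (auto simp: indicator_def)
    then have "(1 :: ennreal) \<le> (SUP n. indicator {\<sigma>. \<exists>k\<le>n. r \<le> norm (walk 0 m k \<sigma>)} \<sigma>)"
      by (intro SUP_upper2[of k]) auto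
    moreover have "(SUP n. indicator {\<sigma>. \<exists>k\<le>n. r \<le> norm (walk 0 m k \<sigma>)} \<sigma>) \<le> (1 :: ennreal)"
      by (intro SUP_least) (simp add: indicator_def)
    ultimately show ?thesis using True by simp
  qed auto
  then have "(\<integral>\<^sup>+\<sigma>. indicator {\<sigma>. \<exists>k. r \<le> norm (walk 0 m k \<sigma>)} \<sigma> \<partial>signs D)
      = (\<integral>\<^sup>+\<sigma>. (SUP n. indicator {\<sigma>. \<exists>k\<le>n. r \<le> norm (walk 0 m k \<sigma>)} \<sigma>) \<partial>signs D)"
    by simp
  also have "\<dots> = (SUP n. \<integral>\<^sup>+\<sigma>. indicator {\<sigma>. \<exists>k\<le>n. r \<le> norm (walk 0 m k \<sigma>)} \<sigma> \<partial>signs D)"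
    by (intro nn_integral_monotone_convergence_SUP incseq_SucI le_funI)
      (auto simp: indicator_def le_Suc_eq)
  also have "\<dots> \<le> ennreal ((\<Sum>k. (norm (y (k + m)))\<^sup>2) / r\<^sup>2)"
  proof (rule SUP_least)
    fix n
    have "(\<Sum>k=m..<m + n. (norm (y k))\<^sup>2) = (\<Sum>k<n. (norm (y (k + m)))\<^sup>2)"
      using sum.shift_bounds_nat_ivl[of "\<lambda>k. (norm (y k))\<^sup>2" 0 m n]
      by (simp add: add.commute lessThan_atLeast0)
    also have "\<dots> \<le> (\<Sum>k. (norm (y (k + m)))\<^sup>2)"
      using y by (intro sum_le_suminf) (auto simp: summable_iff_shift[of "\<lambda>k. (norm (y k))\<^sup>2"])
    finally have "((norm (0 :: 'b))\<^sup>2 + (\<Sum>k=m..<m + n. (norm (y k))\<^sup>2)) / r\<^sup>2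
        \<le> (\<Sum>k. (norm (y (k + m)))\<^sup>2) / r\<^sup>2"
      by (simp add: divide_right_mono)
    then show "(\<integral>\<^sup>+\<sigma>. indicator {\<sigma>. \<exists>k\<le>n. r \<le> norm (walk 0 m k \<sigma>)} \<sigma> \<partial>signs D)
        \<le> ennreal ((\<Sum>k. (norm (y (k + m)))\<^sup>2) / r\<^sup>2)"
      by (intro order_trans[OF walk_maximal_inequality[OF r]] ennreal_leI)
  qed
  finally show ?thesis .
qed

text \<open>The tail of the walk after time \<open>m\<close> exceeds \<open>r\<close> with probability at most \<open>(\<Sum>k\<ge>m. \<bar>y k\<bar>\<^sup>2) / r\<^sup>2\<close>, which tends to 0. So almost
  surely the partial sums form a Cauchy sequence.\<close>

lemma AE_summable_random_signs:
  assumes y: "summable (\<lambda>k. (norm (y k))\<^sup>2)"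
  shows "AE \<sigma> in signs D. summable (\<lambda>k. \<sigma> (I k) *\<^sub>R y k)"
proof -
  note I_in [simp, measurable]
  have "AE \<sigma> in signs D. \<exists>m. \<forall>k. norm (walk 0 m k \<sigma>) < r" if r: "0 < r" for r
  proof -
    define bad where "bad = {\<sigma>. \<forall>m. \<exists>k. r \<le> norm (walk 0 m k \<sigma>)}"
    have [measurable]: "Measurable.pred (signs D) (\<lambda>\<sigma>. \<forall>m. \<exists>k. r \<le> norm (walk 0 m k \<sigma>))"
      by measurable
    have "(\<integral>\<^sup>+\<sigma>. indicator bad \<sigma> \<partial>signs D) \<le> ennreal ((\<Sum>k. (norm (y (k + m)))\<^sup>2) / r\<^sup>2)" for m
    proof -
      have "(\<integral>\<^sup>+\<sigma>. indicator bad \<sigma> \<partial>signs D)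
          \<le> (\<integral>\<^sup>+\<sigma>. indicator {\<sigma>. \<exists>k. r \<le> norm (walk 0 m k \<sigma>)} \<sigma> \<partial>signs D)"
        by (intro nn_integral_mono) (auto simp: indicator_def bad_def)
      also note walk_tail_inequality[OF r y]
      finally show ?thesis .
    qed
    moreover have "(\<lambda>m. ennreal ((\<Sum>k. (norm (y (k + m)))\<^sup>2) / r\<^sup>2)) \<longlonglongrightarrow> ennreal (0 / r\<^sup>2)"
      using r by (intro tendsto_ennrealI tendsto_divide suminf_exist_split2[OF y] tendsto_const) auto
    ultimately have "(\<integral>\<^sup>+\<sigma>. indicator bad \<sigma> \<partial>signs D) \<le> ennreal (0 / r\<^sup>2)"
      by (intro LIMSEQ_le_const) auto
    then have "(\<integral>\<^sup>+\<sigma>. indicator bad \<sigma> \<partial>signs D) = 0" by simp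
    then have "AE \<sigma> in signs D. indicator bad \<sigma> = (0 :: ennreal)"
      by (subst (asm) nn_integral_0_iff_AE) (simp_all add: bad_def)
    then show ?thesis
      by eventually_elim (auto simp: bad_def indicator_def not_le split: if_splits)
  qed
  then have "AE \<sigma> in signs D. \<forall>j. \<exists>m. \<forall>k. norm (walk 0 m k \<sigma>) < inverse (real (Suc j))"
    by (subst AE_all_countable) simp
  then show ?thesis
  proof eventually_elim
    case (elim \<sigma>)
    let ?a = "\<lambda>k. \<sigma> (I k) *\<^sub>R y k"
    show "summable ?a"
      unfolding summable_Cauchy
    proof (intro allI impI)
      fix e :: real assume "0 < e"
      then obtain j where j: "inverse (real (Suc j)) < e / 2"
        using reals_Archimedean[of "e / 2"] by auto
      from elim obtain M where M: "\<And>k. norm (walk 0 M k \<sigma>) < inverse (real (Suc j))" by blast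
      have M': "norm (sum ?a {M..<n}) < e / 2" for n
      proof (cases "M \<le> n")
        case True
        then show ?thesis using M[of "n - M"] j by simp
      qed (use \<open>0 < e\<close> in simp)
      have "norm (sum ?a {m..<n}) < e" if "M \<le> m" for m n
      proof (cases "m \<le> n")
        case True
        then have "sum ?a {M..<n} - sum ?a {M..<m} = sum ?a {m..<n}"
          using that by (simp add: sum_diff_nat_ivl)
        then have "norm (sum ?a {m..<n}) \<le> norm (sum ?a {M..<n}) + norm (sum ?a {M..<m})"
          by (metis norm_triangle_ineq4)
        then show ?thesis using M'[of n] M'[of m] by simp
      qed (use \<open>0 < e\<close> in simp)
      then show "\<exists>N. \<forall>m\<ge>N. \<forall>n. norm (sum ?a {m..<n}) < e" by blast
    qed
  qed
qed

text \<open>Fatou's lemma, applied to the partial sums, whose second moments are known.\<close>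

lemma nn_integral_random_signs_le:
  assumes y: "summable (\<lambda>k. (norm (y k))\<^sup>2)"
  shows "(\<integral>\<^sup>+\<sigma>. ennreal ((norm (\<Sum>k. \<sigma> (I k) *\<^sub>R y k))\<^sup>2) \<partial>signs D) \<le> ennreal (\<Sum>k. (norm (y k))\<^sup>2)"
proof -
  note I_in [simp, measurable]
  let ?S = "\<lambda>n \<sigma>. ennreal ((norm (walk 0 0 n \<sigma>))\<^sup>2)"
  have "AE \<sigma> in signs D. ennreal ((norm (\<Sum>k. \<sigma> (I k) *\<^sub>R y k))\<^sup>2) = liminf (\<lambda>n. ?S n \<sigma>)"
    using AE_summable_random_signs[OF y]
  proof eventually_elim
    case (elim \<sigma>)
    have "(\<lambda>n. ?S n \<sigma>) \<longlonglongrightarrow> ennreal ((norm (\<Sum>k. \<sigma> (I k) *\<^sub>R y k))\<^sup>2)"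
      using summable_LIMSEQ[OF elim]
      by (intro tendsto_ennrealI tendsto_power tendsto_norm) (simp add: lessThan_atLeast0)
    from lim_imp_Liminf[OF sequentially_bot this] show ?case by simp
  qed
  then have "(\<integral>\<^sup>+\<sigma>. ennreal ((norm (\<Sum>k. \<sigma> (I k) *\<^sub>R y k))\<^sup>2) \<partial>signs D)
      = (\<integral>\<^sup>+\<sigma>. liminf (\<lambda>n. ?S n \<sigma>) \<partial>signs D)"
    by (rule nn_integral_cong_AE)
  also have "\<dots> \<le> liminf (\<lambda>n. \<integral>\<^sup>+\<sigma>. ?S n \<sigma> \<partial>signs D)"
    by (rule nn_integral_liminf) measurable
  also have "\<dots> = liminf (\<lambda>n. ennreal (\<Sum>k<n. (norm (y k))\<^sup>2))"
    by (simp only: walk_second_moment) (simp add: lessThan_atLeast0)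
  also have "\<dots> = ennreal (\<Sum>k. (norm (y k))\<^sup>2)"
    using summable_LIMSEQ[OF y] by (intro lim_imp_Liminf tendsto_ennrealI) auto
  finally show ?thesis .
qed

end

section \<open>Stopping on the dyadic tree\<close>

text \<open>A node \<open>(n, k)\<close> with \<open>k < 2 ^ n\<close> stands for the dyadic interval \<open>[k / 2 ^ n, (k + 1) / 2 ^ n]\<close>;
  the parent of \<open>(Suc n, k)\<close> is \<open>(n, k div 2)\<close>.\<close>

type_synonym node = "nat \<times> nat"

text \<open>The smallest stopping interval that contains the node. The root is one; below a stopping interval \<open>Q\<close>, the
  maximal nodes \<open>L\<close> with \<open>stop Q L\<close> are the next ones.\<close>

primrec principal :: "(node \<Rightarrow> node \<Rightarrow> bool) \<Rightarrow> nat \<Rightarrow> nat \<Rightarrow> node" where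
  "principal stop 0 k = (0, k)"
| "principal stop (Suc n) k =
     (if stop (principal stop n (k div 2)) (Suc n, k) then (Suc n, k)
      else principal stop n (k div 2))"

definition principal_nodes :: "(node \<Rightarrow> node \<Rightarrow> bool) \<Rightarrow> node set" where
  "principal_nodes stop = {(m, j). j < 2 ^ m \<and> principal stop m j = (m, j)}"

text \<open>The nodes of generation \<open>n\<close> whose smallest stopping interval is \<open>Q\<close>. The blocks of the principal nodes
  partition the tree.\<close>

definition block :: "(node \<Rightarrow> node \<Rightarrow> bool) \<Rightarrow> node \<Rightarrow> nat \<Rightarrow> nat set" where
  "block stop Q n = {k. k < 2 ^ n \<and> principal stop n k = Q}"

lemma finite_block [simp]: "finite (block stop Q n)"
  by (simp add: block_def)

lemma principal_ancestor:
  assumes "principal stop n k = (m, j)"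
  shows "m \<le> n \<and> j = k div 2 ^ (n - m) \<and> principal stop m j = (m, j)"
  using assms
proof (induction n arbitrary: k)
  case (Suc n)
  show ?case
  proof (cases "stop (principal stop n (k div 2)) (Suc n, k)")
    case False
    with Suc.prems have "principal stop n (k div 2) = (m, j)" by simp
    from Suc.IH[OF this] show ?thesis
      by (auto simp: Suc_diff_le div_mult2_eq)
  qed (use Suc.prems in auto)
qed auto

lemma principal_in_principal_nodes:
  assumes "k < 2 ^ n"
  shows "principal stop n k \<in> principal_nodes stop" "fst (principal stop n k) \<le> n"
proof -
  obtain m j where mj: "principal stop n k = (m, j)" by force
  note anc = principal_ancestor[OF mj]
  have "j < 2 ^ m"
    using anc assms by (simp add: less_mult_imp_div_less flip: power_add)
  with anc mj show "principal stop n k \<in> principal_nodes stop" "fst (principal stop n k) \<le> n"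
    by (auto simp: principal_nodes_def)
qed

lemma block_less: "n < fst Q \<Longrightarrow> block stop Q n = {}"
  using principal_ancestor[of stop n _ "fst Q" "snd Q"] by (auto simp: block_def)

lemma block_start:
  assumes "(m, j) \<in> principal_nodes stop"
  shows "block stop (m, j) m = {j}"
  using assms principal_ancestor[of stop m _ m j] by (auto simp: block_def principal_nodes_def)

text \<open>The parent of \<open>(m, j)\<close> lies in another block, so this recursion over the generations starts at \<open>m\<close>.\<close>

lemma block_Suc:
  assumes "m \<le> n"
  shows "block stop (m, j) (Suc n) = {k. k div 2 \<in> block stop (m, j) n \<and> \<not> stop (m, j) (Suc n, k)}"
  using assms by (auto simp: block_def split: if_splits)

lemma sum_children:
  fixes a :: "nat \<Rightarrow> 'a::comm_monoid_add"
  assumes "finite X"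
  shows "(\<Sum>k\<in>X. a (2 * k) + a (2 * k + 1)) = (\<Sum>k | k div 2 \<in> X. a k)"
proof -
  have eq: "{k. k div 2 \<in> X} = (\<lambda>k. 2 * k) ` X \<union> (\<lambda>k. 2 * k + 1) ` X" (is "?L = ?R")
  proof (intro equalityI subsetI)
    fix k assume "k \<in> ?L"
    moreover have "k = 2 * (k div 2) \<or> k = 2 * (k div 2) + 1" by arith
    ultimately show "k \<in> ?R" by blast
  qed auto
  have "(\<lambda>k. 2 * k) ` X \<inter> (\<lambda>k. 2 * k + 1) ` X = {}"
    by (auto, presburger)
  then have "(\<Sum>k | k div 2 \<in> X. a k) = (\<Sum>k\<in>(\<lambda>k. 2 * k) ` X. a k) + (\<Sum>k\<in>(\<lambda>k. 2 * k + 1) ` X. a k)"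
    unfolding eq using assms by (intro sum.union_disjoint) auto
  also have "\<dots> = (\<Sum>k\<in>X. a (2 * k)) + (\<Sum>k\<in>X. a (2 * k + 1))"
    by (simp add: sum.reindex inj_on_def)
  finally show ?thesis by (simp add: sum.distrib)
qed

text \<open>A potential \<open>\<theta>\<close> that grows by at least \<open>h\<close> when a node is split, and that is nonpositive on the
  children where the block of \<open>Q\<close> ends, bounds the sum of \<open>h\<close> over the block.\<close>

lemma block_potential:
  fixes h \<theta> :: "nat \<Rightarrow> nat \<Rightarrow> real"
  assumes Q: "(m, j) \<in> principal_nodes stop"
    and split: "\<And>n k. m \<le> n \<Longrightarrow> k \<in> block stop (m, j) n \<Longrightarrow>
        h n k + \<theta> n k \<le> \<theta> (Suc n) (2 * k) + \<theta> (Suc n) (2 * k + 1)"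
    and exit: "\<And>n k. m \<le> n \<Longrightarrow> k div 2 \<in> block stop (m, j) n \<Longrightarrow> stop (m, j) (Suc n, k) \<Longrightarrow>
        \<theta> (Suc n) k \<le> 0"
    and "m \<le> N"
  shows "(\<Sum>n=m..<N. \<Sum>k\<in>block stop (m, j) n. h n k) + \<theta> m j
      \<le> (\<Sum>k\<in>block stop (m, j) N. \<theta> N k)"
  using \<open>m \<le> N\<close>
proof (induction N rule: dec_induct)
  case base
  then show ?case using block_start[OF Q] by simp
next
  case (step n)
  let ?X = "block stop (m, j)"
  have fin: "finite {k. k div 2 \<in> ?X n}"
  proof (rule finite_subset)
    show "{k. k div 2 \<in> ?X n} \<subseteq> {..<2 ^ Suc n}" by (auto simp: block_def)
  qed simp
  have "(\<Sum>n=m..<Suc n. \<Sum>k\<in>?X n. h n k) + \<theta> m j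
      \<le> (\<Sum>k\<in>?X n. h n k) + (\<Sum>k\<in>?X n. \<theta> n k)"
    using step by simp
  also have "\<dots> \<le> (\<Sum>k\<in>?X n. \<theta> (Suc n) (2 * k) + \<theta> (Suc n) (2 * k + 1))"
    unfolding sum.distrib[symmetric, of "h n"] by (intro sum_mono split) (use step in auto)
  also have "\<dots> = (\<Sum>k | k div 2 \<in> ?X n. \<theta> (Suc n) k)"
    by (rule sum_children) simp
  also have "\<dots> \<le> (\<Sum>k | k div 2 \<in> ?X n. if k \<in> ?X (Suc n) then \<theta> (Suc n) k else 0)"
    using exit step by (intro sum_mono) (auto simp: block_Suc)
  also have "\<dots> = (\<Sum>k\<in>?X (Suc n). \<theta> (Suc n) k)"
    using fin step by (subst sum.inter_restrict[symmetric]) (auto simp: block_Suc intro!: sum.cong)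
  finally show ?case .
qed

lemma sum_over_blocks:
  fixes h :: "nat \<Rightarrow> nat \<Rightarrow> real"
  shows "(\<Sum>n<N. \<Sum>k<2 ^ n. h n k)
      = (\<Sum>Q\<in>principal_nodes stop \<inter> {..<N} \<times> UNIV. \<Sum>n<N. \<Sum>k\<in>block stop Q n. h n k)"
proof -
  let ?S = "SIGMA n:{..<N}. {..<2 ^ n :: nat}"
  let ?T = "principal_nodes stop \<inter> {..<N} \<times> UNIV"
  let ?g = "\<lambda>(n, k). principal stop n k"
  have "?T \<subseteq> ?S" by (auto simp: principal_nodes_def)
  then have "finite ?T" by (rule finite_subset) simp
  have "(\<Sum>n<N. \<Sum>k<2 ^ n. h n k) = (\<Sum>(n, k)\<in>?S. h n k)"
    by (simp add: sum.Sigma)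
  also have "\<dots> = (\<Sum>Q\<in>?T. \<Sum>(n, k)\<in>{x \<in> ?S. ?g x = Q}. h n k)"
  proof (rule sum.group[symmetric])
    show "?g ` ?S \<subseteq> ?T"
    proof (rule image_subsetI)
      fix x assume "x \<in> ?S"
      then show "?g x \<in> ?T"
        using principal_in_principal_nodes[of "snd x" "fst x" stop]
        by (cases "?g x") (auto simp: case_prod_beta)
    qed
  qed (use \<open>finite ?T\<close> in auto)
  also have "\<dots> = (\<Sum>Q\<in>?T. \<Sum>n<N. \<Sum>k\<in>block stop Q n. h n k)"
  proof (rule sum.cong[OF refl])
    fix Q
    have "{x \<in> ?S. ?g x = Q} = (SIGMA n:{..<N}. block stop Q n)"
      by (auto simp: block_def)
    then show "(\<Sum>(n, k)\<in>{x \<in> ?S. ?g x = Q}. h n k) = (\<Sum>n<N. \<Sum>k\<in>block stop Q n. h n k)"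
      by (simp add: sum.Sigma)
  qed
  finally show ?thesis .
qed

section \<open>Dyadic intervals and Haar coefficients\<close>

definition dyad :: "nat \<Rightarrow> nat \<Rightarrow> real set" where
  "dyad n k = {real k / 2 ^ n .. (real k + 1) / 2 ^ n}"

lemma dyadic_gen_eq: "dyadic_gen n = dyad n ` {..<2 ^ n}"
  by (auto simp: dyadic_gen_def dyad_def)

lemma dyad_in_dyadic: "k < 2 ^ n \<Longrightarrow> dyad n k \<in> dyadic"
  by (auto simp: dyadic_def dyadic_gen_eq)

lemma dyad_ends_le: "real k / 2 ^ n \<le> (real k + 1) / 2 ^ n"
  by (rule divide_right_mono) simp_all

lemma len_dyad: "len (dyad n k) = 1 / 2 ^ n"
proof -
  have "measure lebesgue {a..b} = b - a" if "a \<le> b" for a b :: real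
    using that by simp
  from this[OF dyad_ends_le] show ?thesis
    by (simp only: len_def dyad_def flip: diff_divide_distrib) simp
qed

lemma Inf_dyad: "Inf (dyad n k) = real k / 2 ^ n" and Sup_dyad: "Sup (dyad n k) = (real k + 1) / 2 ^ n"
  unfolding dyad_def by (rule cInf_atLeastAtMost[OF dyad_ends_le] cSup_atLeastAtMost[OF dyad_ends_le])+

lemma left_half_dyad: "left_half (dyad n k) = dyad (Suc n) (2 * k)"
  and right_half_dyad: "right_half (dyad n k) = dyad (Suc n) (2 * k + 1)"
  unfolding left_half_def right_half_def Inf_dyad Sup_dyad by (simp_all add: dyad_def field_simps)

lemma dyad_inject:
  assumes "dyad n k = dyad m j"
  shows "n = m" "k = j"
proof -
  from assms have "len (dyad n k) = len (dyad m j)" by simp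
  then have "(2 :: real) ^ n = 2 ^ m" by (simp add: len_dyad)
  then show "n = m" by simp
  from assms have "Inf (dyad n k) = Inf (dyad m j)" by simp
  with \<open>n = m\<close> show "k = j" by (simp add: Inf_dyad)
qed

lemma dyad_subset_J:
  assumes "k < 2 ^ n"
  shows "dyad n k \<subseteq> J"
proof -
  have "real k + 1 \<le> real (2 ^ n)"
    using assms by linarith
  then have "(real k + 1) / 2 ^ n \<le> 1"
    by simp
  then show ?thesis by (auto simp: dyad_def intro: order_trans[of 0 "real k / 2 ^ n"])
qed

lemma dyad_sets [measurable, simp]: "dyad n k \<in> sets lebesgue"
  by (simp add: dyad_def)

text \<open>This index belongs to the half-open intervals: an endpoint is counted to the interval on its right.\<close>

definition dyad_index :: "nat \<Rightarrow> real \<Rightarrow> nat" where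
  "dyad_index n x = nat \<lfloor>2 ^ n * x\<rfloor>"

lemma dyad_index_eq_iff:
  assumes "0 \<le> x"
  shows "dyad_index n x = k \<longleftrightarrow> real k / 2 ^ n \<le> x \<and> x < (real k + 1) / 2 ^ n"
proof -
  have "dyad_index n x = k \<longleftrightarrow> \<lfloor>2 ^ n * x\<rfloor> = int k"
    using assms by (auto simp: dyad_index_def)
  also have "\<dots> \<longleftrightarrow> real k \<le> 2 ^ n * x \<and> 2 ^ n * x < real k + 1"
    by (simp add: floor_eq_iff)
  finally show ?thesis by (simp add: field_simps)
qed

lemma dyad_index_less:
  assumes "0 \<le> x" "x < 1"
  shows "dyad_index n x < 2 ^ n"
proof -
  have "real (dyad_index n x) / 2 ^ n < 1"
    using dyad_index_eq_iff[OF assms(1), THEN iffD1, OF refl, of n] assms(2) by linarith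
  then have "real (dyad_index n x) < real (2 ^ n)" by simp
  then show ?thesis by (simp only: of_nat_less_iff)
qed

lemma dyad_index_Suc:
  assumes "0 \<le> x"
  shows "dyad_index (Suc n) x div 2 = dyad_index n x"
proof -
  let ?k = "dyad_index (Suc n) x"
  have k: "real ?k / 2 ^ Suc n \<le> x" "x < (real ?k + 1) / 2 ^ Suc n"
    using dyad_index_eq_iff[OF assms, of "Suc n" ?k] by auto
  have "2 * real (?k div 2) \<le> real ?k" "real ?k + 1 \<le> 2 * real (?k div 2) + 2"
    by linarith+
  then have "2 * real (?k div 2) / 2 ^ Suc n \<le> real ?k / 2 ^ Suc n"
    "(real ?k + 1) / 2 ^ Suc n \<le> (2 * real (?k div 2) + 2) / 2 ^ Suc n"
    by (intro divide_right_mono, simp, simp)+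
  moreover have "2 * real (?k div 2) / 2 ^ Suc n = real (?k div 2) / 2 ^ n"
    "(2 * real (?k div 2) + 2) / 2 ^ Suc n = (real (?k div 2) + 1) / 2 ^ n"
    by (simp_all add: field_simps)
  ultimately have "dyad_index n x = ?k div 2"
    using k by (simp only: dyad_index_eq_iff[OF assms]) linarith
  then show ?thesis by simp
qed

text \<open>Off this null set the closed dyadic intervals of one generation do not overlap.\<close>

definition dyadic_points :: "real set" where
  "dyadic_points = (\<Union>n. range (\<lambda>k :: nat. real k / 2 ^ n))"

lemma dyadic_points_null: "dyadic_points \<in> null_sets lebesgue"
proof -
  have "countable dyadic_points"
    unfolding dyadic_points_def by (intro countable_UN) auto
  then show ?thesis
    by (rule countable_imp_null_set_lborel[THEN null_sets_completionI])
qed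

lemma mem_dyad_iff:
  assumes x: "x \<in> J" "x \<notin> dyadic_points"
  shows "x \<in> dyad n k \<longleftrightarrow> k = dyad_index n x"
proof -
  have "x \<noteq> real (Suc k) / 2 ^ n"
    using x(2) unfolding dyadic_points_def by blast
  then show ?thesis
    using x(1) dyad_index_eq_iff[of x n k] by (auto simp: dyad_def add.commute)
qed

lemma haar_dyad:
  "haar (dyad n k) x = (indicator (dyad (Suc n) (2 * k + 1)) x - indicator (dyad (Suc n) (2 * k)) x) * sqrt (2 ^ n)"
  by (simp add: haar_def left_half_dyad right_half_dyad len_dyad real_sqrt_divide)

lemma haar_eq_0:
  assumes x: "x \<in> J" "x \<notin> dyadic_points" and "k \<noteq> dyad_index n x"
  shows "haar (dyad n k) x = 0"
proof -
  have "dyad_index (Suc n) x div 2 \<noteq> k"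
    using assms dyad_index_Suc[of x n] by simp
  then have "dyad_index (Suc n) x \<noteq> 2 * k" "dyad_index (Suc n) x \<noteq> 2 * k + 1" by auto
  then show ?thesis
    by (simp add: haar_dyad indicator_def mem_dyad_iff[OF x])
qed

lemma haar_power2:
  assumes x: "x \<in> J" "x \<notin> dyadic_points"
  shows "(haar (dyad n (dyad_index n x)) x)\<^sup>2 = 2 ^ n"
proof -
  let ?k = "dyad_index n x"
  have "dyad_index (Suc n) x div 2 = ?k"
    using x dyad_index_Suc[of x n] by simp
  then consider "dyad_index (Suc n) x = 2 * ?k" | "dyad_index (Suc n) x = 2 * ?k + 1" by linarith
  then show ?thesis
    by cases (simp_all add: haar_dyad indicator_def mem_dyad_iff[OF x] power_mult_distrib)
qed

lemma AE_leb_J_nondyadic: "AE x in leb_J. x \<in> J \<and> x \<notin> dyadic_points \<and> x < 1"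
proof -
  have "1 \<in> dyadic_points"
    unfolding dyadic_points_def by (auto intro!: exI[of _ 0] image_eqI[of _ _ 1])
  have "AE x in lebesgue. x \<notin> dyadic_points"
    by (rule AE_not_in[OF dyadic_points_null])
  then have "AE x in lebesgue. x \<in> J \<longrightarrow> x \<notin> dyadic_points"
    by (rule eventually_mono) simp
  then have "AE x in leb_J. x \<notin> dyadic_points"
    by (subst AE_restrict_space_iff) simp_all
  moreover have "AE x in leb_J. x \<in> J"
    by (rule AE_I2) simp
  ultimately show ?thesis
    by eventually_elim (use \<open>1 \<in> dyadic_points\<close> less_eq_real_def in auto)
qed

subsection \<open>Integrals over dyadic intervals\<close>

lemma integrable_dyad:
  fixes g :: "real \<Rightarrow> 'b::euclidean_space"
  assumes "integrable leb_J g" "k < 2 ^ n"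
  shows "integrable (lebesgue_on (dyad n k)) g"
proof -
  have "set_integrable lebesgue J g"
    using assms(1) by (simp add: integrable_restrict_space set_integrable_def)
  then have "set_integrable lebesgue (dyad n k) g"
    by (rule set_integrable_subset) (use dyad_subset_J[OF assms(2)] in auto)
  then show ?thesis by (simp add: integrable_restrict_space set_integrable_def)
qed

lemma lebesgue_integral_dyad:
  fixes g :: "real \<Rightarrow> 'b::euclidean_space"
  assumes "integrable leb_J g" "k < 2 ^ n"
  shows "(\<integral>x. g x \<partial>lebesgue_on (dyad n k)) = integral (dyad n k) g"
  by (rule lebesgue_integral_eq_integral[OF integrable_dyad[OF assms]]) simp

lemma integrable_on_dyad:
  fixes g :: "real \<Rightarrow> 'b::euclidean_space"
  assumes "integrable leb_J g" "k < 2 ^ n"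
  shows "g integrable_on dyad n k"
  by (rule integrable_on_lebesgue_on[OF integrable_dyad[OF assms]]) simp

lemma integral_dyad_split:
  fixes g :: "real \<Rightarrow> 'b::euclidean_space"
  assumes "integrable leb_J g" "k < 2 ^ n"
  shows "integral (dyad n k) g = integral (dyad (Suc n) (2 * k)) g + integral (dyad (Suc n) (2 * k + 1)) g"
proof -
  have "real k / 2 ^ n = real (2 * k) / 2 ^ Suc n" "(real k + 1) / 2 ^ n = (real (2 * k + 1) + 1) / 2 ^ Suc n"
    by (simp_all add: field_simps)
  moreover have "real (2 * k) / 2 ^ Suc n \<le> real (2 * k + 1) / 2 ^ Suc n"
    "real (2 * k + 1) / 2 ^ Suc n \<le> (real (2 * k + 1) + 1) / 2 ^ Suc n"
    by (rule divide_right_mono; simp)+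
  moreover have "real (2 * k) + 1 = real (2 * k + 1)" by simp
  ultimately show ?thesis
    using Henstock_Kurzweil_Integration.integral_combine[of "real (2 * k) / 2 ^ Suc n" "real (2 * k + 1) / 2 ^ Suc n"
        "(real (2 * k + 1) + 1) / 2 ^ Suc n" g] integrable_on_dyad[OF assms]
    by (simp only: dyad_def)
qed

lemma average_dyad:
  fixes g :: "real \<Rightarrow> 'b::euclidean_space"
  assumes "integrable leb_J g" "k < 2 ^ n"
  shows "average g (dyad n k) = 2 ^ n *\<^sub>R integral (dyad n k) g"
  by (simp add: average_def len_dyad lebesgue_integral_dyad[OF assms])

lemma integral_indicator_dyad:
  fixes g :: "real \<Rightarrow> 'b::euclidean_space"
  assumes "integrable leb_J g" "k < 2 ^ n"
  shows "integrable leb_J (\<lambda>x. indicator (dyad n k) x *\<^sub>R g x)"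
    "(\<integral>x. indicator (dyad n k) x *\<^sub>R g x \<partial>leb_J) = integral (dyad n k) g"
proof -
  have eq: "(indicator J x * indicator (dyad n k) x) *\<^sub>R g x = indicator (dyad n k) x *\<^sub>R g x" for x
    using dyad_subset_J[OF assms(2)] by (auto simp: indicator_def)
  have "set_integrable lebesgue (dyad n k) g"
    using integrable_dyad[OF assms] by (simp add: integrable_restrict_space set_integrable_def)
  then show "integrable leb_J (\<lambda>x. indicator (dyad n k) x *\<^sub>R g x)"
    by (simp add: integrable_restrict_space set_integrable_def eq)
  have "(\<integral>x. indicator (dyad n k) x *\<^sub>R g x \<partial>leb_J) = (\<integral>x. g x \<partial>lebesgue_on (dyad n k))"
    by (simp add: integral_restrict_space eq)
  then show "(\<integral>x. indicator (dyad n k) x *\<^sub>R g x \<partial>leb_J) = integral (dyad n k) g"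
    by (simp add: lebesgue_integral_dyad[OF assms])
qed

lemma haar_coeff_dyad:
  fixes g :: "real \<Rightarrow> complex ^ 'd"
  assumes g: "integrable leb_J g" and k: "k < 2 ^ n"
  shows "haar_coeff g (dyad n k)
    = sqrt (2 ^ n) *\<^sub>R (integral (dyad (Suc n) (2 * k + 1)) g - integral (dyad (Suc n) (2 * k)) g)"
proof -
  have k': "2 * k < 2 ^ Suc n" "2 * k + 1 < 2 ^ Suc n" using k by auto
  have "haar_coeff g (dyad n k) = (\<integral>x. sqrt (2 ^ n) *\<^sub>R
      (indicator (dyad (Suc n) (2 * k + 1)) x *\<^sub>R g x - indicator (dyad (Suc n) (2 * k)) x *\<^sub>R g x) \<partial>leb_J)"
    unfolding haar_coeff_def haar_dyad by (simp add: algebra_simps)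
  then show ?thesis
    using integral_indicator_dyad[OF g k'(1)] integral_indicator_dyad[OF g k'(2)] by simp
qed

text \<open>By the parallelogram law, the squared Haar coefficient is the increment of \<open>\<bar>I\<bar> \<bar>\<langle>g\<rangle>\<^sub>I\<bar>\<^sup>2\<close> when \<open>I\<close> is replaced by its
  two halves. Such increments telescope.\<close>

lemma norm_haar_coeff:
  fixes g :: "real \<Rightarrow> complex ^ 'd"
  assumes g: "integrable leb_J g" and k: "k < 2 ^ n"
  shows "(norm (haar_coeff g (dyad n k)))\<^sup>2 + 2 ^ n * (norm (integral (dyad n k) g))\<^sup>2
    = 2 ^ Suc n * (norm (integral (dyad (Suc n) (2 * k)) g))\<^sup>2
      + 2 ^ Suc n * (norm (integral (dyad (Suc n) (2 * k + 1)) g))\<^sup>2"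
proof -
  let ?L = "integral (dyad (Suc n) (2 * k)) g" and ?R = "integral (dyad (Suc n) (2 * k + 1)) g"
  have "(norm (?R - ?L))\<^sup>2 + (norm (?L + ?R))\<^sup>2 = 2 * (norm ?L)\<^sup>2 + 2 * (norm ?R)\<^sup>2"
    by (simp add: power2_norm_eq_inner inner_add inner_diff inner_commute)
  then have "2 ^ n * ((norm (?R - ?L))\<^sup>2 + (norm (?L + ?R))\<^sup>2) = 2 ^ n * (2 * (norm ?L)\<^sup>2 + 2 * (norm ?R)\<^sup>2)"
    by simp
  then show ?thesis
    unfolding haar_coeff_dyad[OF assms] integral_dyad_split[OF assms]
    by (simp add: power_mult_distrib distrib_left)
qed

section \<open>Stopping when averages grow\<close>

text \<open>\<open>\<Phi> Q i L\<close> is the mass on \<open>L\<close> of the \<open>i\<close>-th of finitely many measures attached to the stopping interval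
  \<open>Q\<close>. A subinterval is stopped when one of its average masses exceeds \<open>M\<close> times that of \<open>Q\<close>; since the
  \<open>i\<close>-th mass stops at most the fraction \<open>1 / M\<close> of \<open>Q\<close>, at least half of \<open>Q\<close> is not stopped.\<close>

locale stopping_masses =
  fixes \<Phi> :: "node \<Rightarrow> 'i::finite \<Rightarrow> node \<Rightarrow> real" and M :: real
  assumes mass_nonneg: "k < 2 ^ n \<Longrightarrow> 0 \<le> \<Phi> Q i (n, k)"
    and mass_split: "k < 2 ^ n \<Longrightarrow> \<Phi> Q i (n, k) = \<Phi> Q i (Suc n, 2 * k) + \<Phi> Q i (Suc n, 2 * k + 1)"
    and M_ge: "2 * real CARD('i) \<le> M"
begin

definition stop :: "node \<Rightarrow> node \<Rightarrow> bool" where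
  "stop Q L \<longleftrightarrow> (\<exists>i. M * (2 ^ fst Q * \<Phi> Q i Q) < 2 ^ fst L * \<Phi> Q i L)"

lemma M_ge_2: "2 \<le> M"
proof -
  have "1 \<le> real CARD('i)" using zero_less_card_finite[where 'a = 'i] by linarith
  then show ?thesis using M_ge by linarith
qed

lemma mass_child:
  assumes "k div 2 < 2 ^ n"
  shows "\<Phi> Q i (Suc n, k) \<le> \<Phi> Q i (n, k div 2)"
proof -
  have "2 * (k div 2) < 2 ^ Suc n" "2 * (k div 2) + 1 < 2 ^ Suc n" using assms by auto
  then have "0 \<le> \<Phi> Q i (Suc n, 2 * (k div 2))" "0 \<le> \<Phi> Q i (Suc n, 2 * (k div 2) + 1)"
    by (auto intro: mass_nonneg)
  moreover have "k = 2 * (k div 2) \<or> k = 2 * (k div 2) + 1" by linarith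
  ultimately show ?thesis
    using mass_split[OF assms, of Q i] by (metis add_increasing add_increasing2 order_refl)
qed

lemma mass_block:
  assumes "m \<le> n" "(m, j) \<in> principal_nodes stop" "k \<in> block stop (m, j) n"
  shows "\<Phi> (m, j) i (n, k) \<le> \<Phi> (m, j) i (m, j)"
  using assms(1,3)
proof (induction n arbitrary: k rule: dec_induct)
  case base
  then show ?case using block_start[OF assms(2)] by simp
next
  case (step n)
  then have k: "k div 2 \<in> block stop (m, j) n" by (simp add: block_Suc)
  then have "k div 2 < 2 ^ n" by (simp add: block_def)
  from mass_child[OF this] step.IH[OF k] show ?case by (rule order_trans)
qed

lemma average_block:
  assumes "m \<le> n" "(m, j) \<in> principal_nodes stop" "k \<in> block stop (m, j) n"
  shows "2 ^ n * \<Phi> (m, j) i (n, k) \<le> M * (2 ^ m * \<Phi> (m, j) i (m, j))"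
proof (cases "n = m")
  case True
  then have "k = j" using block_start assms by blast
  have "0 \<le> 2 ^ m * \<Phi> (m, j) i (m, j)"
    using assms(2) by (auto simp: principal_nodes_def intro!: mult_nonneg_nonneg mass_nonneg)
  then have "1 * (2 ^ m * \<Phi> (m, j) i (m, j)) \<le> M * (2 ^ m * \<Phi> (m, j) i (m, j))"
    using M_ge_2 by (intro mult_right_mono) auto
  then show ?thesis using True \<open>k = j\<close> by simp
next
  case False
  then obtain n' where n: "n = Suc n'" "m \<le> n'" using assms(1) by (cases n) auto
  then have "\<not> stop (m, j) (n, k)" using assms(3) by (simp add: block_Suc)
  then show ?thesis by (simp add: stop_def not_less)
qed

text \<open>\<open>\<psi>\<close> is additive, at most \<open>\<bar>Q\<bar> / 2\<close> on \<open>Q\<close> and at least \<open>\<bar>L\<bar>\<close> on a stopped interval \<open>L\<close>. So the potential \<open>\<bar>L\<bar> - \<psi> L\<close>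
  loses nothing when stopped intervals are dropped.\<close>

lemma block_measure_ge:
  assumes "m \<le> N" and Q: "(m, j) \<in> principal_nodes stop"
  shows "1 / 2 * (1 / 2 ^ m) \<le> real (card (block stop (m, j) N)) / 2 ^ N"
proof -
  let ?\<Phi> = "\<Phi> (m, j)"
  define \<psi> where "\<psi> n k = (\<Sum>i\<in>UNIV. ?\<Phi> i (n, k) / (M * 2 ^ m * ?\<Phi> i (m, j)))" for n k
  have j: "j < 2 ^ m" using Q by (simp add: principal_nodes_def)
  have M0: "0 < M" using M_ge_2 by simp
  have \<Phi>Q: "0 \<le> ?\<Phi> i (m, j)" for i using j by (rule mass_nonneg)
  have \<psi>_nonneg: "0 \<le> \<psi> n k" if "k < 2 ^ n" for n k
    unfolding \<psi>_def using that j M0 by (intro sum_nonneg divide_nonneg_nonneg mult_nonneg_nonneg mass_nonneg) auto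
  have "(\<Sum>n=m..<N. \<Sum>k\<in>block stop (m, j) n. 0) + (1 / 2 ^ m - \<psi> m j)
      \<le> (\<Sum>k\<in>block stop (m, j) N. 1 / 2 ^ N - \<psi> N k)"
  proof (rule block_potential[OF Q _ _ \<open>m \<le> N\<close>])
    fix n k assume "k \<in> block stop (m, j) n"
    then have k: "k < 2 ^ n" by (simp add: block_def)
    have "\<psi> n k = \<psi> (Suc n) (2 * k) + \<psi> (Suc n) (2 * k + 1)"
      unfolding \<psi>_def mass_split[OF k] by (simp add: add_divide_distrib sum.distrib)
    then show "0 + (1 / 2 ^ n - \<psi> n k)
        \<le> 1 / 2 ^ Suc n - \<psi> (Suc n) (2 * k) + (1 / 2 ^ Suc n - \<psi> (Suc n) (2 * k + 1))"
      by simp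
  next
    fix n k assume n: "m \<le> n" and k: "k div 2 \<in> block stop (m, j) n" and "stop (m, j) (Suc n, k)"
    then obtain i where i: "M * (2 ^ m * ?\<Phi> i (m, j)) < 2 ^ Suc n * ?\<Phi> i (Suc n, k)"
      by (auto simp: stop_def)
    have k2: "k div 2 < 2 ^ n" using k by (simp add: block_def)
    then have "k < 2 ^ Suc n" by simp
    \<comment> \<open>otherwise the \<open>i\<close>-th summand of \<open>\<psi>\<close> would be a division by zero\<close>
    have "?\<Phi> i (m, j) \<noteq> 0"
    proof
      assume "?\<Phi> i (m, j) = 0"
      with mass_block[OF n Q k, of i] mass_child[OF k2, of "(m, j)" i]
      have "?\<Phi> i (Suc n, k) \<le> 0" by linarith
      then have "2 ^ Suc n * ?\<Phi> i (Suc n, k) \<le> 0" by (rule mult_nonneg_nonpos[rotated]) simp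
      with i \<open>?\<Phi> i (m, j) = 0\<close> show False by simp
    qed
    then have pos: "0 < M * 2 ^ m * ?\<Phi> i (m, j)" using \<Phi>Q[of i] M0 by simp
    then have "1 / 2 ^ Suc n \<le> ?\<Phi> i (Suc n, k) / (M * 2 ^ m * ?\<Phi> i (m, j))"
      using i by (simp add: divide_le_eq le_divide_eq mult_ac)
    also have "\<dots> \<le> \<psi> (Suc n) k"
      unfolding \<psi>_def using \<open>k < 2 ^ Suc n\<close> j M0
      by (intro member_le_sum divide_nonneg_nonneg mult_nonneg_nonneg mass_nonneg) auto
    finally show "1 / 2 ^ Suc n - \<psi> (Suc n) k \<le> 0" by simp
  qed
  also have "\<dots> \<le> (\<Sum>k\<in>block stop (m, j) N. 1 / 2 ^ N)"
    by (intro sum_mono) (simp add: \<psi>_nonneg block_def)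
  finally have "1 / 2 ^ m - \<psi> m j \<le> real (card (block stop (m, j) N)) / 2 ^ N"
    by simp
  moreover have "\<psi> m j \<le> 1 / 2 * (1 / 2 ^ m)"
  proof -
    have "\<psi> m j \<le> (\<Sum>i\<in>(UNIV :: 'i set). 1 / (M * 2 ^ m))"
      unfolding \<psi>_def using M0 by (intro sum_mono) simp
    also have "\<dots> = real CARD('i) / M * (1 / 2 ^ m)" by simp
    also have "\<dots> \<le> 1 / 2 * (1 / 2 ^ m)"
      using M_ge M0 by (intro mult_right_mono) (simp_all add: divide_le_eq)
    finally show ?thesis .
  qed
  ultimately show ?thesis by linarith
qed

text \<open>The points of \<open>Q\<close> that lie in no smaller stopping interval. Each point has one half-open dyadic interval in
  every generation, so these sets are disjoint although neighbouring closed dyadic intervals share an endpoint.\<close>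

definition kept :: "node \<Rightarrow> real set" where
  "kept Q = {x \<in> {0..<1}. \<forall>n\<ge>fst Q. principal stop n (dyad_index n x) = Q}"

lemma kept_measure:
  assumes Q: "(m, j) \<in> principal_nodes stop"
  shows "kept (m, j) \<in> sets lebesgue" "1 / 2 * (1 / 2 ^ m) \<le> measure lebesgue (kept (m, j))"
    "kept (m, j) \<subseteq> dyad m j"
proof -
  define cell :: "nat \<Rightarrow> nat \<Rightarrow> real set" where "cell n k = {real k / 2 ^ n ..< (real k + 1) / 2 ^ n}" for n k
  define G where "G n = {x \<in> {0..<1}. dyad_index n x \<in> block stop (m, j) n}" for n
  have G_cells: "G n = (\<Union>k\<in>block stop (m, j) n. cell n k)" for n
  proof (intro equalityI subsetI)
    fix x assume "x \<in> G n"
    then show "x \<in> (\<Union>k\<in>block stop (m, j) n. cell n k)"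
      using dyad_index_eq_iff[of x n "dyad_index n x"] by (auto simp: G_def cell_def)
  next
    fix x assume "x \<in> (\<Union>k\<in>block stop (m, j) n. cell n k)"
    then obtain k where k: "k \<in> block stop (m, j) n" and x: "real k / 2 ^ n \<le> x" "x < (real k + 1) / 2 ^ n"
      by (auto simp: cell_def)
    have "x \<in> dyad n k" using x by (simp add: dyad_def)
    then have "x \<in> J" using dyad_subset_J[of k n] k by (auto simp: block_def)
    have "real k + 1 \<le> real (2 ^ n)" using k by (simp only: block_def) (auto simp del: of_nat_power)
    then have "(real k + 1) / 2 ^ n \<le> 1" by simp
    then have "x < 1" using x by linarith
    moreover have "dyad_index n x = k"
      using x \<open>x \<in> J\<close> by (simp add: dyad_index_eq_iff)
    ultimately show "x \<in> G n" using k \<open>x \<in> J\<close> by (simp add: G_def)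
  qed
  have cell_measure: "measure lebesgue (cell n k) = 1 / 2 ^ n" for n k
  proof -
    have "measure lebesgue {a..<b} = b - a" if "a \<le> b" for a b :: real
      using that by simp
    from this[OF dyad_ends_le] show ?thesis
      by (simp only: cell_def flip: diff_divide_distrib) simp
  qed
  have cell_lmeas: "cell n k \<in> lmeasurable" for n k
    unfolding cell_def
    by (intro bounded_set_imp_lmeasurable bounded_subset[OF bounded_closed_interval atLeastLessThan_subseteq_atLeastAtMost_iff[THEN iffD2]]) auto
  have disj: "disjoint_family_on (cell n) (block stop (m, j) n)" for n
  proof (unfold disjoint_family_on_def, intro ballI impI)
    fix k l :: nat assume "k \<noteq> l"
    show "cell n k \<inter> cell n l = {}"
    proof (rule ccontr)
      assume "cell n k \<inter> cell n l \<noteq> {}"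
      then obtain x where x: "x \<in> cell n k" "x \<in> cell n l" by blast
      then have "0 \<le> x" by (auto simp: cell_def intro: order_trans[of 0 "real k / 2 ^ n"])
      with x have "dyad_index n x = k" "dyad_index n x = l"
        by (simp_all add: dyad_index_eq_iff cell_def)
      with \<open>k \<noteq> l\<close> show False by simp
    qed
  qed
  have G_lmeas: "G n \<in> lmeasurable" for n
    unfolding G_cells by (intro fmeasurable.finite_UN cell_lmeas) auto
  have "measure lebesgue (G n) = (\<Sum>k\<in>block stop (m, j) n. measure lebesgue (cell n k))" for n
    unfolding G_cells
    by (intro measure_finite_Union)
      (auto simp: disj fmeasurableD[OF cell_lmeas] fmeasurableD2[OF cell_lmeas] simp del: emeasure_completion)
  then have G_measure: "1 / 2 * (1 / 2 ^ m) \<le> measure lebesgue (G n)" if "m \<le> n" for n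
    using block_measure_ge[OF that Q] by (simp add: cell_measure)
  have kept_G: "kept (m, j) = (\<Inter>i. G (m + i))"
  proof -
    have "x \<in> kept (m, j) \<longleftrightarrow> (\<forall>i. x \<in> G (m + i))" for x
    proof -
      have "(\<forall>n\<ge>m. principal stop n (dyad_index n x) = (m, j))
          \<longleftrightarrow> (\<forall>i. principal stop (m + i) (dyad_index (m + i) x) = (m, j))"
        by (metis le_add1 le_iff_add)
      then show ?thesis
        using dyad_index_less[of x] by (auto simp: kept_def G_def block_def)
    qed
    then show ?thesis by blast
  qed
  have "decseq (\<lambda>i. G (m + i))"
  proof (rule decseq_SucI, rule subsetI)
    fix i x assume "x \<in> G (m + Suc i)"
    then show "x \<in> G (m + i)"
      using dyad_index_Suc[of x "m + i"] by (auto simp: G_def block_Suc)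
  qed
  then have "(\<lambda>i. measure lebesgue (G (m + i))) \<longlonglongrightarrow> measure lebesgue (\<Inter>i. G (m + i))"
    by (intro Lim_measure_decseq)
      (auto simp: fmeasurableD[OF G_lmeas] fmeasurableD2[OF G_lmeas] simp del: emeasure_completion)
  then show "1 / 2 * (1 / 2 ^ m) \<le> measure lebesgue (kept (m, j))"
    unfolding kept_G by (rule LIMSEQ_le_const) (use G_measure in auto)
  show "kept (m, j) \<in> sets lebesgue"
    unfolding kept_G using G_lmeas by (intro sets.countable_INT) (auto simp: fmeasurable_def)
  have "kept (m, j) \<subseteq> cell m j"
    unfolding kept_G G_cells[of "m + 0" for m] using G_cells[of m] block_start[OF Q] by (auto dest!: spec[of _ 0])
  then show "kept (m, j) \<subseteq> dyad m j" by (auto simp: cell_def dyad_def)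
qed

lemma sparse_principal: "sparse_collection ((\<lambda>(n, k). dyad n k) ` principal_nodes stop)"
proof -
  let ?d = "\<lambda>(n, k). dyad n k"
  define node_of where "node_of = the_inv ?d"
  have inj: "inj ?d"
    by (rule injI) (auto dest: dyad_inject)
  have node_of: "node_of (?d Q) = Q" for Q
    unfolding node_of_def by (rule the_inv_f_f[OF inj])
  show ?thesis
    unfolding sparse_collection_def
  proof (intro conjI exI[of _ "\<lambda>I. kept (node_of I)"] ballI)
    show "?d ` principal_nodes stop \<subseteq> dyadic"
      by (auto simp: principal_nodes_def intro: dyad_in_dyadic)
    show "disjoint_family_on (\<lambda>I. kept (node_of I)) (?d ` principal_nodes stop)"
    proof (unfold disjoint_family_on_def, intro ballI impI)
      fix I I' assume I: "I \<in> ?d ` principal_nodes stop" "I' \<in> ?d ` principal_nodes stop" "I \<noteq> I'"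
      have "?d (node_of L) = L" if "L \<in> ?d ` principal_nodes stop" for L
        using that by (rule imageE) (simp only: node_of)
      from this[OF I(1)] this[OF I(2)] \<open>I \<noteq> I'\<close> have ne: "node_of I \<noteq> node_of I'" by metis
      have False if "x \<in> kept Q" "x \<in> kept Q'" "Q \<noteq> Q'" for x Q Q'
      proof -
        have "\<forall>n\<ge>fst Q. principal stop n (dyad_index n x) = Q"
          "\<forall>n\<ge>fst Q'. principal stop n (dyad_index n x) = Q'"
          using that by (simp_all add: kept_def)
        from this(1)[rule_format, OF max.cobounded1] this(2)[rule_format, OF max.cobounded2] that(3)
        show False by metis
      qed
      with ne show "kept (node_of I) \<inter> kept (node_of I') = {}" by blast
    qed
    fix I assume "I \<in> ?d ` principal_nodes stop"
    then obtain m j where Q: "(m, j) \<in> principal_nodes stop" and I: "I = dyad m j" by auto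
    have "node_of I = (m, j)" using node_of[of "(m, j)"] I by simp
    then show "kept (node_of I) \<subseteq> I" "kept (node_of I) \<in> sets lebesgue"
      "1 / 2 * len I \<le> measure lebesgue (kept (node_of I))"
      using kept_measure[OF Q] by (simp_all add: I len_dyad)
  qed
qed

end

section \<open>Averages of a matrix weight\<close>

lemma bounded_linear_cdot_form: "bounded_linear (\<lambda>A. Re (cdot (A *v v) v))"
  for v :: "complex ^ 'd"
proof (rule linear_conv_bounded_linear[THEN iffD1], rule linearI)
  fix A B :: "complex ^ 'd ^ 'd" and r :: real
  show "Re (cdot ((A + B) *v v) v) = Re (cdot (A *v v) v) + Re (cdot (B *v v) v)"
    by (simp add: matrix_vector_mult_add_rdistrib cdot_simps(1))
  have "(r *\<^sub>R A) *v v = r *\<^sub>R (A *v v)"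
    by (simp add: vec_eq_iff matrix_vector_mult_def scaleR_sum_right)
  then show "Re (cdot ((r *\<^sub>R A) *v v) v) = r *\<^sub>R Re (cdot (A *v v) v)"
    by (simp add: cdot_simps(4))
qed

text \<open>Integrals commute with this map, so averages of Hermitian matrices are Hermitian.\<close>

lemma bounded_linear_hermitian_defect: "bounded_linear (\<lambda>A. A $ i $ j - cnj (A $ j $ i))"
  by (intro bounded_linear_sub bounded_linear_compose[OF bounded_linear_cnj]
      bounded_linear_compose[OF bounded_linear_vec_nth] bounded_linear_vec_nth)

lemma bounded_linear_matrix_vector_mult: "bounded_linear ((*v) A)" for A :: "complex ^ 'n ^ 'm"
  by (rule linear_conv_bounded_linear[THEN iffD1, OF linear_matrix_vector_mult])

lemma borel_measurable_vec_nth: "(\<lambda>v :: 'b::topological_space ^ 'n. v $ i) \<in> borel_measurable borel"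
  by (intro borel_measurable_continuous_onI continuous_intros)

lemma integrable_vec:
  fixes f :: "'a \<Rightarrow> ('b::euclidean_space) ^ 'n"
  assumes "\<And>i. integrable M (\<lambda>x. f x $ i)"
  shows "integrable M f"
proof -
  have "integrable M (\<lambda>x. f x \<bullet> b)" if "b \<in> Basis" for b
  proof -
    from that obtain i u where "b = axis i u" by (auto simp: Basis_vec_def)
    then show ?thesis using assms[of i] by (simp add: inner_axis)
  qed
  then have "integrable M (\<lambda>x. \<Sum>b\<in>Basis. (f x \<bullet> b) *\<^sub>R b)"
    by (intro Bochner_Integration.integrable_sum integrable_scaleR_left) auto
  then show ?thesis by (simp add: euclidean_representation)
qed

lemma integrable_entries_imp_integrable:
  "integrable_entries W \<Longrightarrow> integrable leb_J W"
  unfolding integrable_entries_def by (intro integrable_vec) blast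

lemma AE_dyad:
  assumes "AE x in leb_J. P x" "k < 2 ^ n"
  shows "AE x in lebesgue_on (dyad n k). P x"
proof -
  have "AE x in lebesgue. x \<in> J \<longrightarrow> P x"
    using assms(1) by (subst (asm) AE_restrict_space_iff) auto
  then have "AE x in lebesgue. x \<in> dyad n k \<longrightarrow> P x"
    by (rule eventually_mono) (use dyad_subset_J[OF assms(2)] in blast)
  then show ?thesis by (subst AE_restrict_space_iff) auto
qed

locale integrable_weight =
  fixes W :: "real \<Rightarrow> complex ^ 'd ^ 'd"
  assumes W_int: "integrable leb_J W"
    and W_psd: "AE x in leb_J. psd (W x)"
    and W_inv: "AE x in leb_J. invertible (W x)"
begin

lemma form_integrable: "integrable leb_J (\<lambda>x. Re (cdot (W x *v v) v))"
  by (rule integrable_bounded_linear[OF bounded_linear_cdot_form W_int])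

lemma form_average:
  assumes "k < 2 ^ n"
  shows "Re (cdot (average W (dyad n k) *v v) v) = 2 ^ n * integral (dyad n k) (\<lambda>x. Re (cdot (W x *v v) v))"
proof -
  interpret T: bounded_linear "\<lambda>A. Re (cdot (A *v v) v)"
    by (rule bounded_linear_cdot_form)
  have "integral (dyad n k) ((\<lambda>A. Re (cdot (A *v v) v)) \<circ> W) = Re (cdot (integral (dyad n k) W *v v) v)"
    by (rule integral_linear[OF integrable_on_dyad[OF W_int assms] bounded_linear_cdot_form])
  then show ?thesis
    unfolding average_dyad[OF W_int assms] T.scaleR by (simp add: o_def)
qed

lemma W_pos: "AE x in leb_J. psd (W x) \<and> (\<forall>v. v \<noteq> 0 \<longrightarrow> 0 < Re (cdot (W x *v v) v))"
  using W_psd W_inv by eventually_elim (auto intro: psd_invertible_pos)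

lemma average_pos:
  assumes k: "k < 2 ^ n" and v: "v \<noteq> 0"
  shows "0 < Re (cdot (average W (dyad n k) *v v) v)"
proof -
  let ?M = "lebesgue_on (dyad n k)"
  interpret finite_measure ?M
    by (rule finite_measure_lebesgue_on) (simp add: dyad_def)
  have "(\<integral>x. 0 \<partial>?M) < (\<integral>x. Re (cdot (W x *v v) v) \<partial>?M)"
  proof (rule integral_less_AE_space)
    show "integrable ?M (\<lambda>x. Re (cdot (W x *v v) v))"
      by (rule integrable_dyad[OF form_integrable k])
    show "AE x in ?M. 0 < Re (cdot (W x *v v) v)"
      using AE_dyad[OF W_pos k] by eventually_elim (use v in auto)
    have "measure lebesgue (dyad n k) \<noteq> 0"
      using len_dyad[of n k] by (simp add: len_def del: measure_completion)
    then have "emeasure lebesgue (dyad n k) \<noteq> 0"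
      by (metis measure_eq_emeasure_eq_ennreal ennreal_0 order_refl)
    then show "emeasure ?M (space ?M) \<noteq> 0"
      by (simp add: emeasure_restrict_space del: emeasure_completion)
  qed simp
  then show ?thesis
    by (simp add: form_average[OF k] lebesgue_integral_dyad[OF form_integrable k])
qed

lemma average_psd:
  assumes k: "k < 2 ^ n"
  shows "psd (average W (dyad n k))"
proof -
  have "hermitian (average W (dyad n k))"
    unfolding hermitian_def
  proof (intro allI)
    fix i j
    interpret T: bounded_linear "\<lambda>A :: complex ^ 'd ^ 'd. A $ i $ j - cnj (A $ j $ i)"
      by (rule bounded_linear_hermitian_defect)
    have "(\<integral>x. W x $ i $ j - cnj (W x $ j $ i) \<partial>lebesgue_on (dyad n k)) = (\<integral>x. 0 \<partial>lebesgue_on (dyad n k))"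
    proof (rule integral_cong_AE)
      show "AE x in lebesgue_on (dyad n k). W x $ i $ j - cnj (W x $ j $ i) = 0"
        using AE_dyad[OF W_psd k]
      proof eventually_elim
        case (elim x)
        then have "W x $ i $ j = cnj (W x $ j $ i)" unfolding psd_def hermitian_def by blast
        then show ?case by (rule right_minus_eq[THEN iffD2])
      qed
      show "(\<lambda>x. W x $ i $ j - cnj (W x $ j $ i)) \<in> borel_measurable (lebesgue_on (dyad n k))"
        by (rule borel_measurable_integrable[OF
              integrable_bounded_linear[OF bounded_linear_hermitian_defect integrable_dyad[OF W_int k]]])
    qed simp
    then have "average W (dyad n k) $ i $ j - cnj (average W (dyad n k) $ j $ i) = 0"
      unfolding average_def T.scaleR
      by (simp add: integral_bounded_linear[OF bounded_linear_hermitian_defect integrable_dyad[OF W_int k], symmetric])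
    then show "average W (dyad n k) $ i $ j = cnj (average W (dyad n k) $ j $ i)"
      by (rule right_minus_eq[THEN iffD1])
  qed
  moreover have "0 \<le> Re (cdot (average W (dyad n k) *v v) v)" for v
    using average_pos[OF k, of v] by (cases "v = 0") (auto simp: cdot_simps less_imp_le)
  ultimately show ?thesis by (simp add: psd_def)
qed

lemma form_integral_nonneg:
  assumes "k < 2 ^ n"
  shows "0 \<le> integral (dyad n k) (\<lambda>x. Re (cdot (W x *v v) v))"
proof -
  have "0 \<le> 2 ^ n * integral (dyad n k) (\<lambda>x. Re (cdot (W x *v v) v))"
    using psd_Re_nonneg[OF average_psd[OF assms], of v] by (simp only: form_average[OF assms])
  then show ?thesis
    by (metis mult_pos_neg not_le zero_less_numeral zero_less_power)
qed

text \<open>The vectors of \<open>psd_test_vectors\<close> for the average of \<open>W\<close> over \<open>Q\<close>.\<close>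

definition test_vector :: "node \<Rightarrow> 'd \<Rightarrow> complex ^ 'd" where
  "test_vector Q = (SOME u.
     (\<forall>i. Re (cdot (average W (dyad (fst Q) (snd Q)) *v u i) (u i)) = 1) \<and>
     (\<forall>L M v. psd L \<longrightarrow> (\<forall>i. Re (cdot (L *v u i) (u i)) \<le> M) \<longrightarrow>
       Re (cdot (L *v v) v) \<le> real CARD('d) * M * Re (cdot (average W (dyad (fst Q) (snd Q)) *v v) v)))"

lemma test_vector:
  assumes "j < 2 ^ m"
  shows "Re (cdot (average W (dyad m j) *v test_vector (m, j) i) (test_vector (m, j) i)) = 1"
    and "psd L \<Longrightarrow> (\<And>i. Re (cdot (L *v test_vector (m, j) i) (test_vector (m, j) i)) \<le> M) \<Longrightarrow>
       Re (cdot (L *v v) v) \<le> real CARD('d) * M * Re (cdot (average W (dyad m j) *v v) v)"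
proof -
  let ?P = "\<lambda>u. (\<forall>i. Re (cdot (average W (dyad m j) *v u i) (u i)) = 1) \<and>
     (\<forall>L M v. psd L \<longrightarrow> (\<forall>i. Re (cdot (L *v u i) (u i)) \<le> M) \<longrightarrow>
       Re (cdot (L *v v) v) \<le> real CARD('d) * M * Re (cdot (average W (dyad m j) *v v) v))"
  have "\<exists>u :: 'd \<Rightarrow> complex ^ 'd. ?P u"
    by (rule psd_test_vectors[OF average_psd[OF assms] average_pos[OF assms]]) blast+
  then have "?P (test_vector (m, j))"
    unfolding test_vector_def fst_conv snd_conv by (rule someI_ex)
  then show "Re (cdot (average W (dyad m j) *v test_vector (m, j) i) (test_vector (m, j) i)) = 1"
    and "psd L \<Longrightarrow> (\<And>i. Re (cdot (L *v test_vector (m, j) i) (test_vector (m, j) i)) \<le> M) \<Longrightarrow>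
       Re (cdot (L *v v) v) \<le> real CARD('d) * M * Re (cdot (average W (dyad m j) *v v) v)"
    by blast+
qed

lemma weighted_L2_integrable:
  assumes inv: "integrable_entries (\<lambda>x. matrix_inv (W x))" and f: "f \<in> weighted_L2 W"
  shows "integrable leb_J f"
proof -
  have f_meas [measurable]: "f \<in> borel_measurable leb_J"
    using f by (simp add: weighted_L2_def)
  have W_meas [measurable]: "W \<in> borel_measurable leb_J"
    using W_int by (rule borel_measurable_integrable)
  have form_meas [measurable]: "(\<lambda>x. Re (cdot (W x *v f x) (f x))) \<in> borel_measurable leb_J"
  proof -
    note nth = measurable_compose[OF _ borel_measurable_vec_nth]
    have [measurable]: "(\<lambda>x. W x $ i $ j) \<in> borel_measurable leb_J" "(\<lambda>x. f x $ i) \<in> borel_measurable leb_J" for i j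
      by (intro nth W_meas f_meas)+
    show ?thesis
      unfolding cdot_def matrix_vector_mult_def
      by simp
  qed
  have "(\<integral>\<^sup>+x. ennreal (Re (cdot (W x *v f x) (f x))) \<partial>leb_J)
      = (\<integral>\<^sup>+x. ennreal ((norm (msqrt (W x) *v f x))\<^sup>2) \<partial>leb_J)"
    by (rule nn_integral_cong_AE, rule eventually_mono[OF W_psd]) (simp only: norm_msqrt)
  also have "\<dots> < \<infinity>" using f by (simp add: weighted_L2_def)
  finally have form: "integrable leb_J (\<lambda>x. Re (cdot (W x *v f x) (f x)))"
    by (intro integrableI_nonneg form_meas eventually_mono[OF W_psd] psd_Re_nonneg)
  have inv_form: "integrable leb_J (\<lambda>x. Re (cdot (matrix_inv (W x) *v a) a))" for a
    by (rule integrable_bounded_linear[OF bounded_linear_cdot_form integrable_entries_imp_integrable[OF inv]])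
  have "integrable leb_J (\<lambda>x. f x \<bullet> a)" for a
  proof (rule Bochner_Integration.integrable_bound)
    show "integrable leb_J (\<lambda>x. (Re (cdot (W x *v f x) (f x)) + Re (cdot (matrix_inv (W x) *v a) a)) / 2)"
      using form inv_form by simp
    show "AE x in leb_J. norm (f x \<bullet> a)
        \<le> norm ((Re (cdot (W x *v f x) (f x)) + Re (cdot (matrix_inv (W x) *v a) a)) / 2)"
      using W_psd W_inv
    proof eventually_elim
      case (elim x)
      from inner_le_form_inverse[OF elim, of "f x" a] show ?case by simp
    qed
  qed measurable
  then have "integrable leb_J (\<lambda>x. \<Sum>b\<in>Basis. (f x \<bullet> b) *\<^sub>R b)"
    by (intro Bochner_Integration.integrable_sum integrable_scaleR_left)
  then show ?thesis by (simp add: euclidean_representation)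
qed

end

section \<open>Domination by a sparse family\<close>

locale weighted_function = integrable_weight W for W :: "real \<Rightarrow> complex ^ 'd ^ 'd" +
  fixes f :: "real \<Rightarrow> complex ^ 'd"
  assumes f_int: "integrable leb_J f"
begin

definition rescaled :: "node \<Rightarrow> real \<Rightarrow> complex ^ 'd" where
  "rescaled Q x = msqrt (average W (dyad (fst Q) (snd Q))) *v f x"

text \<open>The mass \<open>None\<close> stops \<open>L\<close> when the rescaled function grows. If none of the masses \<open>Some i\<close> stops \<open>L\<close>,
  then \<open>\<langle>W\<rangle>\<^sub>L \<le> d M \<langle>W\<rangle>\<^sub>Q\<close>, by the choice of the test vectors.\<close>

definition mass :: "node \<Rightarrow> 'd option \<Rightarrow> node \<Rightarrow> real" where
  "mass Q i L = integral (dyad (fst L) (snd L)) (\<lambda>x. case i of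
      None \<Rightarrow> norm (rescaled Q x)
    | Some i \<Rightarrow> Re (cdot (W x *v test_vector Q i) (test_vector Q i)))"

lemma rescaled_integrable: "integrable leb_J (rescaled Q)"
  unfolding rescaled_def
  by (rule integrable_bounded_linear[OF bounded_linear_matrix_vector_mult f_int])

lemma mass_integrable:
  "integrable leb_J (\<lambda>x. case i of None \<Rightarrow> norm (rescaled Q x)
    | Some i \<Rightarrow> Re (cdot (W x *v test_vector Q i) (test_vector Q i)))"
  by (cases i) (simp_all add: rescaled_integrable form_integrable)

definition M :: real where "M = 2 * real CARD('d option)"

sublocale stopping_masses mass M
proof
  fix n k and Q :: node and i :: "'d option" assume k: "k < (2 :: nat) ^ n"
  show "0 \<le> mass Q i (n, k)"
    using form_integral_nonneg[OF k]
    by (cases i) (auto simp: mass_def intro!: integral_nonneg integrable_on_dyad[OF _ k] rescaled_integrable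
        integrable_norm)
  show "mass Q i (n, k) = mass Q i (Suc n, 2 * k) + mass Q i (Suc n, 2 * k + 1)"
    unfolding mass_def fst_conv snd_conv by (rule integral_dyad_split[OF mass_integrable k])
qed (simp add: M_def)

lemma sparse_coeff_eq_mass:
  assumes "j < 2 ^ m"
  shows "sparse_coeff W f (dyad m j) = 2 ^ m * mass (m, j) None (m, j)"
  unfolding sparse_coeff_def mass_def
  using average_dyad[OF integrable_norm[OF rescaled_integrable[of "(m, j)"]] assms]
  by (simp add: rescaled_def)

lemma haar_coeff_rescaled:
  assumes "k < 2 ^ n"
  shows "haar_coeff (rescaled Q) (dyad n k) = msqrt (average W (dyad (fst Q) (snd Q))) *v haar_coeff f (dyad n k)"
proof -
  let ?B = "msqrt (average W (dyad (fst Q) (snd Q)))"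
  interpret B: bounded_linear "(*v) ?B" by (rule bounded_linear_matrix_vector_mult)
  have "integral (dyad n' k') (rescaled Q) = ?B *v integral (dyad n' k') f" if "k' < 2 ^ n'" for n' k'
    using integral_linear[OF integrable_on_dyad[OF f_int that] bounded_linear_matrix_vector_mult[of ?B]]
    by (simp add: rescaled_def[abs_def] o_def)
  then show ?thesis
    unfolding haar_coeff_dyad[OF rescaled_integrable assms] haar_coeff_dyad[OF f_int assms]
    using assms by (simp add: B.scaleR B.diff)
qed

text \<open>This is the estimate \<open>\<bar>G\<bar>\<^sub>2\<^sup>2 \<le> \<bar>G\<bar>\<^sub>\<infinity> \<bar>G\<bar>\<^sub>1\<close> for the good part \<open>G\<close> of a Calderon-Zygmund decomposition of the rescaled
  function \<open>g\<close>, written as a telescoping sum. With \<open>a\<close> the average of \<open>\<bar>g\<bar>\<close> on \<open>Q\<close>, every node of the block and every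
  child of such a node has average at most \<open>2 M a\<close>, because a child carries at most the mass of its parent. There
  \<open>\<bar>I\<bar> \<bar>\<langle>g\<rangle>\<^sub>I\<bar>\<^sup>2 \<le> 2 M a \<integral>\<^sub>I \<bar>g\<bar>\<close>, so the potential \<open>\<theta>\<close> is nonpositive, and it grows by the squared Haar
  coefficients.\<close>

lemma rescaled_block_bound:
  assumes Q: "(m, j) \<in> principal_nodes stop" and "m \<le> N"
  shows "(\<Sum>n=m..<N. \<Sum>k\<in>block stop (m, j) n. (norm (haar_coeff (rescaled (m, j)) (dyad n k)))\<^sup>2)
    \<le> 2 * M * ((sparse_coeff W f (dyad m j))\<^sup>2 * len (dyad m j))"
proof -
  let ?g = "rescaled (m, j)" and ?v = "\<lambda>n k. mass (m, j) None (n, k)"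
  define a where "a = sparse_coeff W f (dyad m j)"
  have j: "j < 2 ^ m" using Q by (simp add: principal_nodes_def)
  have a: "a = 2 ^ m * ?v m j" unfolding a_def by (rule sparse_coeff_eq_mass[OF j])
  have a0: "0 \<le> a" using mass_nonneg[OF j] by (simp add: a)
  define \<theta> where "\<theta> n k = 2 ^ n * (norm (integral (dyad n k) ?g))\<^sup>2 - 2 * M * a * ?v n k" for n k
  have \<theta>_nonpos: "\<theta> n k \<le> 0" if k: "k < 2 ^ n" and le: "2 ^ n * ?v n k \<le> 2 * M * a" for n k
  proof -
    have "norm (integral (dyad n k) ?g) \<le> ?v n k"
      unfolding mass_def using integrable_on_dyad[OF rescaled_integrable k]
      by (simp, intro Henstock_Kurzweil_Integration.integral_norm_bound_integral)
         (auto intro!: integrable_on_dyad[OF integrable_norm[OF rescaled_integrable] k])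
    then have "(norm (integral (dyad n k) ?g))\<^sup>2 \<le> (?v n k)\<^sup>2"
      by (rule power_mono) simp
    then have "2 ^ n * (norm (integral (dyad n k) ?g))\<^sup>2 \<le> (2 ^ n * ?v n k) * ?v n k"
      by (simp add: power2_eq_square)
    also have "\<dots> \<le> 2 * M * a * ?v n k"
      using le by (rule mult_right_mono) (rule mass_nonneg[OF k])
    finally show ?thesis by (simp add: \<theta>_def)
  qed
  have block: "k < 2 ^ n \<and> 2 ^ n * ?v n k \<le> M * a" if "m \<le> n" "k \<in> block stop (m, j) n" for n k
    using average_block[OF that(1) Q that(2), of None] that(2) by (simp add: a block_def)
  have "(\<Sum>n=m..<N. \<Sum>k\<in>block stop (m, j) n. (norm (haar_coeff ?g (dyad n k)))\<^sup>2) + \<theta> m j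
      \<le> (\<Sum>k\<in>block stop (m, j) N. \<theta> N k)"
  proof (rule block_potential[OF Q _ _ \<open>m \<le> N\<close>])
    fix n k assume "k \<in> block stop (m, j) n"
    then have k: "k < 2 ^ n" by (simp add: block_def)
    show "(norm (haar_coeff ?g (dyad n k)))\<^sup>2 + \<theta> n k \<le> \<theta> (Suc n) (2 * k) + \<theta> (Suc n) (2 * k + 1)"
      using norm_haar_coeff[OF rescaled_integrable k, of "(m, j)"]
      unfolding \<theta>_def mass_split[OF k] by (simp add: distrib_left)
  next
    fix n k assume n: "m \<le> n" and k: "k div 2 \<in> block stop (m, j) n"
    note k2 = block[OF n k]
    then have "k < 2 ^ Suc n" by auto
    moreover have "2 ^ Suc n * ?v (Suc n) k \<le> 2 * M * a"
    proof -
      have "2 ^ n * ?v (Suc n) k \<le> 2 ^ n * ?v n (k div 2)"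
        using k2 by (intro mult_left_mono mass_child) auto
      moreover have "2 ^ Suc n * ?v (Suc n) k = 2 * (2 ^ n * ?v (Suc n) k)" by simp
      ultimately show ?thesis using k2 by linarith
    qed
    ultimately show "\<theta> (Suc n) k \<le> 0" by (rule \<theta>_nonpos)
  qed
  also have "\<dots> \<le> 0"
  proof (rule sum_nonpos)
    fix k assume "k \<in> block stop (m, j) N"
    note b = block[OF \<open>m \<le> N\<close> this]
    have "0 \<le> M * a" using a0 M_ge_2 by simp
    then have "2 ^ N * ?v N k \<le> 2 * M * a" using b by linarith
    with b show "\<theta> N k \<le> 0" by (intro \<theta>_nonpos) auto
  qed
  finally have "(\<Sum>n=m..<N. \<Sum>k\<in>block stop (m, j) n. (norm (haar_coeff ?g (dyad n k)))\<^sup>2) \<le> - \<theta> m j"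
    by simp
  also have "\<dots> \<le> 2 * M * a * ?v m j"
    by (simp add: \<theta>_def)
  also have "\<dots> = 2 * M * (a\<^sup>2 * len (dyad m j))"
    by (simp add: len_dyad a power2_eq_square)
  finally show ?thesis by (simp add: a_def)
qed

definition haar_energy :: "nat \<Rightarrow> nat \<Rightarrow> real" where
  "haar_energy n k = Re (cdot (average W (dyad n k) *v haar_coeff f (dyad n k)) (haar_coeff f (dyad n k)))"

text \<open>Within the block of \<open>Q\<close> the bound \<open>\<langle>W\<rangle>\<^sub>I \<le> d M \<langle>W\<rangle>\<^sub>Q\<close> replaces the form of \<open>\<langle>W\<rangle>\<^sub>I\<close> by the norm
  of a Haar coefficient of the rescaled function.\<close>

lemma haar_energy_block:
  assumes Q: "(m, j) \<in> principal_nodes stop" and n: "m \<le> n" and k: "k \<in> block stop (m, j) n"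
  shows "haar_energy n k \<le> real CARD('d) * M * (norm (haar_coeff (rescaled (m, j)) (dyad n k)))\<^sup>2"
proof -
  have j: "j < 2 ^ m" using Q by (simp add: principal_nodes_def)
  have k': "k < 2 ^ n" using k by (simp add: block_def)
  have "Re (cdot (average W (dyad n k) *v test_vector (m, j) i) (test_vector (m, j) i)) \<le> M" for i
  proof -
    have "2 ^ n * mass (m, j) (Some i) (n, k) \<le> M * (2 ^ m * mass (m, j) (Some i) (m, j))"
      by (rule average_block[OF n Q k])
    then show ?thesis
      using test_vector(1)[OF j, of i] by (simp add: form_average[OF k'] form_average[OF j] mass_def)
  qed
  from test_vector(2)[OF j average_psd[OF k'] this] show ?thesis
    unfolding haar_energy_def haar_coeff_rescaled[OF k']
    by (simp add: norm_msqrt[OF average_psd[OF j]])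
qed

lemma haar_energy_partial_sum_le:
  "(\<Sum>n<N. \<Sum>k<2 ^ n. haar_energy n k)
    \<le> (\<Sum>Q\<in>principal_nodes stop \<inter> {..<N} \<times> UNIV.
        2 * real CARD('d) * M\<^sup>2 * ((sparse_coeff W f (dyad (fst Q) (snd Q)))\<^sup>2 * len (dyad (fst Q) (snd Q))))"
  unfolding sum_over_blocks[where stop = stop]
proof (rule sum_mono, clarify)
  fix m j assume Q: "(m, j) \<in> principal_nodes stop" and "m < N"
  have "(\<Sum>n<N. \<Sum>k\<in>block stop (m, j) n. haar_energy n k) = (\<Sum>n=m..<N. \<Sum>k\<in>block stop (m, j) n. haar_energy n k)"
    using \<open>m < N\<close> by (intro sum.mono_neutral_right) (auto simp: block_less)
  also have "\<dots> \<le> (\<Sum>n=m..<N. \<Sum>k\<in>block stop (m, j) n.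
      real CARD('d) * M * (norm (haar_coeff (rescaled (m, j)) (dyad n k)))\<^sup>2)"
    by (intro sum_mono haar_energy_block[OF Q]) auto
  also have "\<dots> = real CARD('d) * M *
      (\<Sum>n=m..<N. \<Sum>k\<in>block stop (m, j) n. (norm (haar_coeff (rescaled (m, j)) (dyad n k)))\<^sup>2)"
    by (simp only: sum_distrib_left)
  also have "\<dots> \<le> real CARD('d) * M * (2 * M * ((sparse_coeff W f (dyad m j))\<^sup>2 * len (dyad m j)))"
    using M_ge_2 \<open>m < N\<close> by (intro mult_left_mono rescaled_block_bound[OF Q]) auto
  finally show "(\<Sum>n<N. \<Sum>k\<in>block stop (m, j) n. haar_energy n k)
      \<le> 2 * real CARD('d) * M\<^sup>2 * ((sparse_coeff W f (dyad (fst (m, j)) (snd (m, j))))\<^sup>2 * len (dyad (fst (m, j)) (snd (m, j))))"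
    by (simp add: power2_eq_square mult_ac)
qed

end

section \<open>The square function in terms of Haar coefficients\<close>

context weighted_function
begin

text \<open>Off the endpoints, one interval of each generation contains \<open>x\<close>, so the multiplier is a series along a
  path in the tree, whose terms carry signs with distinct indices.\<close>

lemma haar_multiplier_along_path:
  assumes x: "x \<in> J" "x \<notin> dyadic_points" "x < 1"
  shows "haar_multiplier \<sigma> f x = (\<Sum>n. \<sigma> (dyad n (dyad_index n x)) *\<^sub>R
    (haar (dyad n (dyad_index n x)) x *\<^sub>R haar_coeff f (dyad n (dyad_index n x))))"
  unfolding haar_multiplier_def
proof (rule suminf_cong)
  fix n
  let ?t = "\<lambda>I. (\<sigma> I * haar I x) *\<^sub>R haar_coeff f I"
  have "(\<Sum>I\<in>dyadic_gen n. ?t I) = (\<Sum>k<2 ^ n. ?t (dyad n k))"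
    unfolding dyadic_gen_eq by (subst sum.reindex) (auto intro: inj_onI dest: dyad_inject)
  also have "\<dots> = (\<Sum>k\<in>{dyad_index n x}. ?t (dyad n k))"
    using x dyad_index_less[of x n] haar_eq_0[OF x(1,2)] by (intro sum.mono_neutral_right) auto
  finally show "(\<Sum>I\<in>dyadic_gen n. ?t I) = \<sigma> (dyad n (dyad_index n x)) *\<^sub>R
    (haar (dyad n (dyad_index n x)) x *\<^sub>R haar_coeff f (dyad n (dyad_index n x)))"
    by simp
qed

text \<open>The random series converges almost surely after multiplication by \<open>msqrt (W x)\<close>, since the squared norms of
  its terms are summable. As \<open>msqrt (W x)\<close> is invertible, the series itself converges, so that its sum has the
  expected meaning.\<close>

lemma square_function_le:
  assumes x: "x \<in> J" "x \<notin> dyadic_points" "x < 1"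
    and W: "psd (W x)" "\<And>v. v \<noteq> 0 \<Longrightarrow> 0 < Re (cdot (W x *v v) v)"
  defines "c n \<equiv> haar_coeff f (dyad n (dyad_index n x))"
  assumes fin: "(\<Sum>n. ennreal (2 ^ n * Re (cdot (W x *v c n) (c n)))) \<noteq> \<infinity>"
  shows "(square_function W f x)\<^sup>2 \<le> (\<Sum>n. ennreal (2 ^ n * Re (cdot (W x *v c n) (c n))))"
proof -
  define I where "I n = dyad n (dyad_index n x)" for n
  define B where "B = msqrt (W x)"
  define b where "b n = haar (I n) x *\<^sub>R c n" for n
  define y where "y n = B *v b n" for n
  obtain R where R: "R ** B = mat 1"
    using msqrt_left_inverse[OF W] unfolding B_def by blast
  interpret B: bounded_linear "(*v) B" by (rule bounded_linear_matrix_vector_mult)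
  interpret R: bounded_linear "(*v) R" by (rule bounded_linear_matrix_vector_mult)
  have RB: "R *v (B *v v) = v" for v
    by (simp add: matrix_vector_mul_assoc R)
  have ynorm: "(norm (y n))\<^sup>2 = 2 ^ n * Re (cdot (W x *v c n) (c n))" for n
    unfolding y_def b_def B.scaleR using haar_power2[OF x(1,2), of n]
    by (simp add: power_mult_distrib I_def B_def norm_msqrt[OF W(1)])
  have sum_y: "summable (\<lambda>n. (norm (y n))\<^sup>2)"
    using fin unfolding ynorm[symmetric] by (intro summable_suminf_not_top) auto
  have inj: "inj I"
    by (rule injI) (auto simp: I_def dest: dyad_inject)
  have ran: "range I \<subseteq> dyadic"
    using x dyad_index_less by (auto simp: I_def intro!: dyad_in_dyadic)
  have "AE \<sigma> in signs dyadic. B *v haar_multiplier \<sigma> f x = (\<Sum>n. \<sigma> (I n) *\<^sub>R y n)"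
    using AE_summable_random_signs[OF inj ran sum_y]
  proof eventually_elim
    case (elim \<sigma>)
    have "R *v (\<sigma> (I n) *\<^sub>R y n) = \<sigma> (I n) *\<^sub>R b n" for n
      by (simp add: R.scaleR y_def RB)
    with R.summable[OF elim] have "summable (\<lambda>n. \<sigma> (I n) *\<^sub>R b n)" by simp
    from B.suminf[OF this] have "B *v (\<Sum>n. \<sigma> (I n) *\<^sub>R b n) = (\<Sum>n. \<sigma> (I n) *\<^sub>R y n)"
      by (simp add: B.scaleR y_def)
    then show ?case
      by (simp add: haar_multiplier_along_path[OF x] I_def b_def c_def)
  qed
  then have "(\<integral>\<^sup>+\<sigma>. ennreal ((norm (B *v haar_multiplier \<sigma> f x))\<^sup>2) \<partial>signs dyadic)
      = (\<integral>\<^sup>+\<sigma>. ennreal ((norm (\<Sum>n. \<sigma> (I n) *\<^sub>R y n))\<^sup>2) \<partial>signs dyadic)"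
    by (intro nn_integral_cong_AE) (auto elim: eventually_mono)
  also have "\<dots> \<le> ennreal (\<Sum>n. (norm (y n))\<^sup>2)"
    by (rule nn_integral_random_signs_le[OF inj ran sum_y])
  also have "\<dots> = (\<Sum>n. ennreal ((norm (y n))\<^sup>2))"
    using sum_y by (intro suminf_ennreal2[symmetric]) auto
  finally show ?thesis
    unfolding square_function_def ennsqrt_power2 ynorm B_def random_signs_def signs_def .
qed

definition energy_density :: "nat \<Rightarrow> real \<Rightarrow> ennreal" where
  "energy_density n x = (\<Sum>k<2 ^ n. indicator (dyad n k) x *
     ennreal (2 ^ n * Re (cdot (W x *v haar_coeff f (dyad n k)) (haar_coeff f (dyad n k)))))"

lemma energy_density_summand_measurable:
  assumes "k < 2 ^ n"
  shows "(\<lambda>x. indicator (dyad n k) x * ennreal (2 ^ n * Re (cdot (W x *v c) c))) \<in> borel_measurable leb_J"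
proof -
  have "dyad n k \<in> sets leb_J"
    using dyad_subset_J[OF assms] by (simp add: sets_restrict_space_iff)
  then have "(\<lambda>x. indicator (dyad n k) x :: ennreal) \<in> borel_measurable leb_J"
    by (rule borel_measurable_indicator)
  moreover have "(\<lambda>x. 2 ^ n * Re (cdot (W x *v c) c)) \<in> borel_measurable leb_J"
    by (intro borel_measurable_times borel_measurable_const borel_measurable_integrable[OF form_integrable])
  ultimately show ?thesis
    by (intro borel_measurable_times_ennreal measurable_compose[OF _ measurable_ennreal])
qed

lemma energy_density_measurable: "energy_density n \<in> borel_measurable leb_J"
  unfolding energy_density_def[abs_def]
  by (intro borel_measurable_sum energy_density_summand_measurable) simp

lemma nn_integral_energy_density:
  "(\<integral>\<^sup>+x. energy_density n x \<partial>leb_J) = (\<Sum>k<2 ^ n. ennreal (haar_energy n k))"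
proof -
  have "(\<integral>\<^sup>+x. indicator (dyad n k) x * ennreal (2 ^ n * Re (cdot (W x *v c) c)) \<partial>leb_J)
      = ennreal (Re (cdot (average W (dyad n k) *v c) c))" if k: "k < 2 ^ n" for k c
  proof -
    let ?q = "\<lambda>x. 2 ^ n * Re (cdot (W x *v c) c)"
    have q: "integrable leb_J ?q" using form_integrable by simp
    have "(\<integral>\<^sup>+x. indicator (dyad n k) x * ennreal (?q x) \<partial>leb_J)
        = (\<integral>\<^sup>+x. ennreal (indicator (dyad n k) x *\<^sub>R ?q x) \<partial>leb_J)"
      by (intro nn_integral_cong) (simp add: indicator_def)
    also have "\<dots> = ennreal (\<integral>x. indicator (dyad n k) x *\<^sub>R ?q x \<partial>leb_J)"
    proof (rule nn_integral_eq_integral[OF integral_indicator_dyad(1)[OF q k]])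
      show "AE x in leb_J. 0 \<le> indicator (dyad n k) x *\<^sub>R ?q x"
        using W_psd by eventually_elim (simp add: psd_Re_nonneg)
    qed
    also have "(\<integral>x. indicator (dyad n k) x *\<^sub>R ?q x \<partial>leb_J) = integral (dyad n k) ?q"
      by (rule integral_indicator_dyad(2)[OF q k])
    also have "\<dots> = Re (cdot (average W (dyad n k) *v c) c)"
      by (simp add: form_average[OF k])
    finally show ?thesis .
  qed
  then show ?thesis
    unfolding energy_density_def haar_energy_def
    by (subst nn_integral_sum) (auto intro!: energy_density_summand_measurable sum.cong)
qed

lemma L2_square_function_le:
  "(L2_norm (square_function W f))\<^sup>2 \<le> (\<Sum>n. \<Sum>k<2 ^ n. ennreal (haar_energy n k))"
proof (cases "(\<Sum>n. \<Sum>k<2 ^ n. ennreal (haar_energy n k)) = \<infinity>")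
  case False
  have total: "(\<integral>\<^sup>+x. (\<Sum>n. energy_density n x) \<partial>leb_J) = (\<Sum>n. \<Sum>k<2 ^ n. ennreal (haar_energy n k))"
    by (subst nn_integral_suminf) (simp_all add: energy_density_measurable nn_integral_energy_density)
  have "AE x in leb_J. (\<Sum>n. energy_density n x) \<noteq> \<infinity>"
  proof (rule nn_integral_PInf_AE)
    note [measurable] = energy_density_measurable
    show "(\<lambda>x. \<Sum>n. energy_density n x) \<in> borel_measurable leb_J" by measurable
  qed (use False in \<open>simp add: total\<close>)
  then have "AE x in leb_J. (square_function W f x)\<^sup>2 \<le> (\<Sum>n. energy_density n x)"
    using AE_leb_J_nondyadic W_pos
  proof eventually_elim
    case (elim x)
    let ?c = "\<lambda>n. haar_coeff f (dyad n (dyad_index n x))"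
    have x: "x \<in> J" "x \<notin> dyadic_points" "x < 1" using elim by auto
    have dens: "energy_density n x = ennreal (2 ^ n * Re (cdot (W x *v ?c n) (?c n)))" for n
    proof -
      have "energy_density n x = (\<Sum>k\<in>{dyad_index n x}. indicator (dyad n k) x *
          ennreal (2 ^ n * Re (cdot (W x *v haar_coeff f (dyad n k)) (haar_coeff f (dyad n k)))))"
        unfolding energy_density_def
        using x dyad_index_less[of x n] by (intro sum.mono_neutral_right) (auto simp: mem_dyad_iff)
      then show ?thesis using x by (simp add: mem_dyad_iff)
    qed
    show ?case
      unfolding dens
      by (rule square_function_le[OF x]) (use elim in \<open>auto simp: dens\<close>)
  qed
  then have "(\<integral>\<^sup>+x. (square_function W f x)\<^sup>2 \<partial>leb_J) \<le> (\<integral>\<^sup>+x. (\<Sum>n. energy_density n x) \<partial>leb_J)"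
    by (rule nn_integral_mono_AE)
  then show ?thesis
    by (simp add: total L2_norm_def ennsqrt_power2)
qed simp

end

section \<open>Sums over the sparse family\<close>

lemma infsum_ennreal_eq_suminf:
  fixes F :: "nat \<Rightarrow> ennreal"
  shows "(\<Sum>\<^sub>\<infinity>n. F n) = (\<Sum>n. F n)"
proof -
  have "(F has_sum (\<Sum>\<^sub>\<infinity>n. F n)) UNIV"
    by (rule has_sum_infsum[OF nonneg_summable_on_complete]) simp
  then show ?thesis by (rule has_sum_imp_sums[THEN sums_unique])
qed

lemma nn_integral_infsum:
  fixes F :: "'i \<Rightarrow> 'a \<Rightarrow> ennreal"
  assumes S: "countable S" and F: "\<And>i. i \<in> S \<Longrightarrow> F i \<in> borel_measurable M"
  shows "(\<integral>\<^sup>+x. (\<Sum>\<^sub>\<infinity>i\<in>S. F i x) \<partial>M) = (\<Sum>\<^sub>\<infinity>i\<in>S. \<integral>\<^sup>+x. F i x \<partial>M)"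
proof (cases "finite S")
  case True
  then show ?thesis using F by (simp add: nn_integral_sum)
next
  case False
  note bij = bij_betw_from_nat_into[OF S False]
  have "(\<Sum>\<^sub>\<infinity>i\<in>S. G i) = (\<Sum>n. G (from_nat_into S n))" for G :: "'i \<Rightarrow> ennreal"
    unfolding infsum_ennreal_eq_suminf[symmetric] by (rule infsum_reindex_bij_betw[OF bij, symmetric])
  moreover have "from_nat_into S n \<in> S" for n
    using False by (intro from_nat_into) auto
  ultimately show ?thesis using F by (simp add: nn_integral_suminf)
qed

lemma sparse_sum_eq_L2_norm:
  assumes S: "S \<subseteq> dyadic"
  shows "(\<Sum>\<^sub>\<infinity>I\<in>S. ennreal ((a I)\<^sup>2 * len I))
    = (L2_norm (\<lambda>x. ennsqrt (\<Sum>\<^sub>\<infinity>I\<in>S. ennreal ((a I)\<^sup>2) * indicator I x)))\<^sup>2"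
proof -
  have "countable dyadic"
    unfolding dyadic_def dyadic_gen_eq by (intro countable_UN) auto
  then have "countable S" using S by (rule countable_subset[rotated])
  have I: "I \<in> sets leb_J \<and> emeasure leb_J I = ennreal (len I)" if "I \<in> S" for I
  proof -
    from that S obtain n k where k: "k < 2 ^ n" and I: "I = dyad n k"
      by (auto simp: dyadic_def dyadic_gen_eq)
    have "dyad n k \<in> lmeasurable" by (simp add: dyad_def)
    then have "emeasure lebesgue (dyad n k) = ennreal (len (dyad n k))"
      unfolding len_def by (rule emeasure_eq_measure2[OF])
    then show ?thesis
      using dyad_subset_J[OF k] by (simp add: I sets_restrict_space_iff emeasure_restrict_space del: emeasure_completion)
  qed
  have "(\<Sum>\<^sub>\<infinity>I\<in>S. ennreal ((a I)\<^sup>2 * len I)) = (\<Sum>\<^sub>\<infinity>I\<in>S. \<integral>\<^sup>+x. ennreal ((a I)\<^sup>2) * indicator I x \<partial>leb_J)"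
    using I by (intro infsum_cong) (simp add: nn_integral_cmult_indicator ennreal_mult')
  also have "\<dots> = (\<integral>\<^sup>+x. (\<Sum>\<^sub>\<infinity>I\<in>S. ennreal ((a I)\<^sup>2) * indicator I x) \<partial>leb_J)"
    using I by (intro nn_integral_infsum[symmetric, OF \<open>countable S\<close>]) (auto intro!: borel_measurable_times_ennreal borel_measurable_indicator)
  finally show ?thesis by (simp add: L2_norm_def ennsqrt_power2)
qed

lemma (in weighted_function) haar_energy_sum_le:
  defines "S \<equiv> (\<lambda>(n, k). dyad n k) ` principal_nodes stop"
  shows "(\<Sum>n. \<Sum>k<2 ^ n. ennreal (haar_energy n k))
    \<le> ennreal (2 * real CARD('d) * M\<^sup>2) * (\<Sum>\<^sub>\<infinity>I\<in>S. ennreal ((sparse_coeff W f I)\<^sup>2 * len I))"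
  unfolding suminf_eq_SUP
proof (rule SUP_least)
  fix N
  let ?t = "\<lambda>I. (sparse_coeff W f I)\<^sup>2 * len I" and ?d = "\<lambda>Q :: node. dyad (fst Q) (snd Q)"
  let ?T = "principal_nodes stop \<inter> {..<N} \<times> UNIV"
  have "?T \<subseteq> (SIGMA n:{..<N}. {..<2 ^ n})" by (auto simp: principal_nodes_def)
  then have fin: "finite ?T" by (rule finite_subset) simp
  have t: "0 \<le> ?t I" for I by (simp add: len_def)
  have energy: "0 \<le> haar_energy n k" if "k < 2 ^ n" for n k
    unfolding haar_energy_def by (rule psd_Re_nonneg[OF average_psd[OF that]])
  have "(\<Sum>n<N. \<Sum>k<2 ^ n. ennreal (haar_energy n k)) = ennreal (\<Sum>n<N. \<Sum>k<2 ^ n. haar_energy n k)"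
  proof -
    have "(\<Sum>k<2 ^ n. ennreal (haar_energy n k)) = ennreal (\<Sum>k<2 ^ n. haar_energy n k)" for n
      by (rule sum_ennreal) (simp add: energy)
    then show ?thesis
      by (simp only:) (rule sum_ennreal, intro sum_nonneg energy, simp)
  qed
  also have "\<dots> \<le> ennreal (\<Sum>Q\<in>?T. 2 * real CARD('d) * M\<^sup>2 * ?t (?d Q))"
    by (rule ennreal_leI[OF haar_energy_partial_sum_le])
  also have "\<dots> = ennreal (2 * real CARD('d) * M\<^sup>2) * (\<Sum>Q\<in>?T. ennreal (?t (?d Q)))"
    unfolding sum_distrib_left[symmetric]
    by (subst sum_ennreal, rule t, rule ennreal_mult) (simp_all only: sum_nonneg t, simp)
  also have "(\<Sum>Q\<in>?T. ennreal (?t (?d Q))) = (\<Sum>I\<in>?d ` ?T. ennreal (?t I))"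
    by (subst sum.reindex) (auto intro!: inj_onI dest: dyad_inject simp: prod_eq_iff)
  also have "\<dots> \<le> (\<Sum>\<^sub>\<infinity>I\<in>S. ennreal (?t I))"
  proof -
    have "?d ` ?T \<subseteq> S" by (auto simp: S_def)
    with fin have "(\<Sum>I\<in>?d ` ?T. ennreal (?t I)) \<le> (SUP F\<in>{F. finite F \<and> F \<subseteq> S}. \<Sum>I\<in>F. ennreal (?t I))"
      by (intro SUP_upper) simp
    then show ?thesis by (subst nonneg_infsum_complete) simp_all
  qed
  finally show "(\<Sum>n<N. \<Sum>k<2 ^ n. ennreal (haar_energy n k))
      \<le> ennreal (2 * real CARD('d) * M\<^sup>2) * (\<Sum>\<^sub>\<infinity>I\<in>S. ennreal (?t I))"
    by (simp add: mult_left_mono)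
qed

theorem proposition1:
  "\<exists>C::real. C > 0 \<and>
    (\<forall>(W :: real \<Rightarrow> complex ^ 'd ^ 'd) (f :: real \<Rightarrow> complex ^ 'd).
      matrix_weight W \<longrightarrow>
      (AE x in leb_J. invertible (W x)) \<longrightarrow>
      integrable_entries (\<lambda>x. matrix_inv (W x)) \<longrightarrow>
      f \<in> weighted_L2 W \<longrightarrow>
      (\<exists>S. sparse_collection S \<and>
        (L2_norm (square_function W f))\<^sup>2
          \<le> ennreal C * (\<Sum>\<^sub>\<infinity>I\<in>S. ennreal ((sparse_coeff W f I)\<^sup>2 * len I)) \<and>
        ennreal C * (\<Sum>\<^sub>\<infinity>I\<in>S. ennreal ((sparse_coeff W f I)\<^sup>2 * len I))
          = ennreal C * (L2_norm (\<lambda>x. ennsqrt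
              (\<Sum>\<^sub>\<infinity>I\<in>S. ennreal ((sparse_coeff W f I)\<^sup>2) * indicator I x)))\<^sup>2))"
proof (intro exI conjI allI impI)
  let ?C = "2 * real CARD('d) * (2 * real CARD('d option))\<^sup>2"
  show "?C > 0" by simp
  fix W :: "real \<Rightarrow> complex ^ 'd ^ 'd" and f :: "real \<Rightarrow> complex ^ 'd"
  assume W: "matrix_weight W" and invertible: "AE x in leb_J. invertible (W x)"
    and inverse: "integrable_entries (\<lambda>x. matrix_inv (W x))" and f: "f \<in> weighted_L2 W"
  interpret integrable_weight W
    using W invertible by unfold_locales (simp_all add: matrix_weight_def integrable_entries_imp_integrable)
  interpret weighted_function W f
    by unfold_locales (rule weighted_L2_integrable[OF inverse f])
  let ?S = "(\<lambda>(n, k). dyad n k) ` principal_nodes stop"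
  show "sparse_collection ?S" by (rule sparse_principal)
  show "(L2_norm (square_function W f))\<^sup>2
      \<le> ennreal ?C * (\<Sum>\<^sub>\<infinity>I\<in>?S. ennreal ((sparse_coeff W f I)\<^sup>2 * len I))"
    using order_trans[OF L2_square_function_le haar_energy_sum_le] by (simp only: M_def)
  have "?S \<subseteq> dyadic" using sparse_principal by (simp add: sparse_collection_def)
  from sparse_sum_eq_L2_norm[OF this, of "sparse_coeff W f"]
  show "ennreal ?C * (\<Sum>\<^sub>\<infinity>I\<in>?S. ennreal ((sparse_coeff W f I)\<^sup>2 * len I))
      = ennreal ?C * (L2_norm (\<lambda>x. ennsqrt
          (\<Sum>\<^sub>\<infinity>I\<in>?S. ennreal ((sparse_coeff W f I)\<^sup>2) * indicator I x)))\<^sup>2"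
    by (rule arg_cong)
qed

end
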